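(* Let $\mathcal H$ be a transactional memory. Suppose that for every history $H\in\mathcal H$, $H$ is consistent ($\mathsf{cons}(H)$) and there exists an opacity graph $G\in\mathsf{Graph}(H)$ that is acyclic. Then $\mathcal H\sqsubseteq\mathcal H_{\mathsf{atomic}}$, i.e. for every $H\in\mathcal H$ there exists $S\in\mathcal H_{\mathsf{atomic}}$ with $H\sqsubseteq S$.
   Context: **Actions and histories.** Fix threads $\mathsf{ThreadID}=\{1,\dots,N\}$, a set $\mathsf{Reg}$ of integer-valued shared registers with initial value $v_{\mathsf{init}}$, and a set of action identifiers. An interface action is a triple $(a,t,k)$ ($a$ an identifier, $t$ a thread). Requests have $k\in\{\mathsf{begintx},\mathsf{trycommit},\mathsf{write}(x,v),\mathsf{read}(x)\}$ ($x\in\mathsf{Reg}$, $v\in\mathbb Z$). Matching responses are: $\mathsf{ok}$ or $\mathsf{aborted}$ for $\mathsf{begintx}$; $\mathsf{committed}$ or $\mathsf{aborted}$ for $\mathsf{trycommit}$; $\mathsf{ret}(\bot)$ or $\mathsf{aborted}$ for $\mathsf{write}(x,v)$; $\mathsf{ret}(v)$ ($v\in\mathbb Z$) or $\mathsf{aborted}$ for $\mathsf{read}(x)$. A history is a finite sequence $H=H(1)H(2)\cdots$ of interface actions such that: identifiers are pairwise distinct; for each thread $t$ the projection $H|_t$ to actions of $t$ alternates requests and matching responses, starting with a request; for each $t$, in the projection of $H|_t$ to $\mathsf{begintx},\mathsf{committed},\mathsf{aborted}$ actions, $\mathsf{begintx}$ alternates with $\mathsf{committed}$ or $\mathsf{aborted}$,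 starting with $\mathsf{begintx}$, and $\mathsf{trycommit}$ occurs only inside transactions; every read/write request of a thread all of whose earlier transactions are completed (a non-transactional request) is immediately followed by its response, which is not $\mathsf{aborted}$. A transaction in $H$ is a maximal subsequence of actions of one thread starting with $\mathsf{begintx}$ in which only the last action may be $\mathsf{committed}$ or $\mathsf{aborted}$. It is committed, aborted or commit-pending if it ends with $\mathsf{committed}$, $\mathsf{aborted}$ or $\mathsf{trycommit}$ respectively, and live otherwise. Actions outside transactions are non-transactional; a non-transactional access is a matching request/response pair of a read or write outside transactions. A transactional memory (TM) is a prefix-closed set of histories (prefixes that are themselves histories) closed under appending any request action whenever the result is a history. **Atomic TM.** A history is non-interleaved if actions of one transaction do not overlap with actions of another transaction or of non-transactional accesses. A completion of a non-interleaved $H$ is a non-interleaved history $H^c$ without commit-pending transactions, having $H$ as a subsequence, whose additional actions are all $\mathsf{committed}$ or $\mathsf{aborted}$. $\mathcal H_{\mathsf{atomic}}$ is the set of non-interleaved histories $H$ having a completion $H^c$ in which every response to a $\mathsf{read}(x)$ returning a value returns the value $v$ of the last preceding $\mathsf{write}(x,v)$ not located in an aborted or live transaction different from that of the read, or $v_{\mathsf{init}}$ if there is no such write. **Correspondence.** $\alpha<_H\alpha'$ means $\alpha$ occurs before $\alpha'$ in $H$. $\alpha<_{\mathsf{po}(H)}\alpha'$ iff $\alpha<_H\alpha'$ and both are by the same thread; $\alpha<_{\mathsf{cl}(H)}\alpha'$ iff $\alpha<_H\alpha'$ and both are non-transactional. $H_1\sqsubseteq H_2$ iff there is a bijection $\theta:\{1,\dots,|H_1|\}\to\{1,\dots,|H_2|\}$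 with $H_1(i)=H_2(\theta(i))$ for all $i$ and, for $i<j$, $H_1(i)<_{\mathsf{po}(H_1)\cup\mathsf{cl}(H_1)}H_1(j)$ implies $\theta(i)<\theta(j)$. **Consistency.** A read (request with its value response) of $x$ in a transaction $T$ is local if $T$ contains an earlier write request to $x$; a write to $x$ in $T$ is local if $T$ contains a later write request to $x$. All other reads and writes (including all non-transactional ones) are non-local. $\mathsf{cons}(H)$ holds if every read of $x$ returning a value $v$ satisfies: if it is local to $T$, then $v$ is the value of the most recent write to $x$ preceding it in $T$; if it is non-local, then either there is a non-local write request $(\_,\_,\mathsf{write}(x,v))$ in $H$ not located in an aborted or live transaction, or there is none and $v=v_{\mathsf{init}}$. **Opacity graphs.** An opacity graph of $H$ is a tuple $G=(\mathcal V,\mathsf{vis},\mathsf{WR},\mathsf{WW},\mathsf{RW},\mathsf{PO},\mathsf{CL})$ where: $\mathcal V$ is the set of all transactions and non-transactional accesses of $H$; $\mathsf{vis}\subseteq\mathcal V$ is a predicate that holds of all non-transactional accesses and committed transactions and does not hold of aborted and live transactions (it may or may not hold of commit-pending ones); for each $x\in\mathsf{Reg}$: - $\mathsf{WR}_x\subseteq\mathcal V\times\mathcal V$ is such that: $\nu\xrightarrow{\mathsf{WR}_x}\nu'$ implies $\nu\ne\nu'$, $\mathsf{vis}(\nu)$, and, for some $v$, $\nu$ contains a request $\mathsf{write}(x,v)$ and $\nu'$ contains a request $\mathsf{read}(x)$ with matching response $\mathsf{ret}(v)$; and each $\nu'$ has at most one $\nu$ with $\nu\xrightarrow{\mathsf{WR}_x}\nu'$.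 - $\mathsf{WW}_x$ is an irreflexive total order on $\{\nu\in\mathcal V\mid\mathsf{vis}(\nu),\ \nu\text{ contains a write request to }x\}$. - $\nu\xrightarrow{\mathsf{RW}_x}\nu'$ iff $\nu\neq\nu'$ and either $\exists\nu''.\ \nu''\xrightarrow{\mathsf{WW}_x}\nu'\wedge\nu''\xrightarrow{\mathsf{WR}_x}\nu$, or $\mathsf{vis}(\nu')$, $\nu'$ contains a write request to $x$, and $\nu$ contains a read of $x$ returning $v_{\mathsf{init}}$. Finally, for $\nu\ne\nu'$, $\nu\xrightarrow{\mathsf{PO}}\nu'$ (resp. $\mathsf{CL}$) iff there are $\alpha\in\nu,\alpha'\in\nu'$ with $\alpha<_{\mathsf{po}(H)}\alpha'$ (resp. $\alpha<_{\mathsf{cl}(H)}\alpha'$). $\mathsf{Graph}(H)$ is the set of opacity graphs of $H$; $G$ is acyclic if its edges (all of $\mathsf{WR}_x,\mathsf{WW}_x,\mathsf{RW}_x$ for all $x$, $\mathsf{PO}$, $\mathsf{CL}$) form no directed cycle.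
   Formalization: Opacity graphs must also give every node with a non-local read of x returning v ≠ v_init a WR_x-predecessor containing a non-local write(x,v); with WR empty the claim fails (write a; write b; read a in one thread). Action identifiers are assumed infinite. *)

theory Defs
  imports Main "HOL-Library.Sublist" "HOL-Library.Infinite_Typeclass"
begin

datatype 'x kind =
    BeginTx | TryCommit | WriteReq 'x int | ReadReq 'x
  | OkResp | Committed | Aborted | RetUnit | RetVal int

type_synonym ('i, 'x) action = "'i \<times> nat \<times> 'x kind"
type_synonym ('i, 'x) history = "('i, 'x) action list"

definition ident :: "('i, 'x) action \<Rightarrow> 'i" where
  "ident a = fst a"

definition thread :: "('i, 'x) action \<Rightarrow> nat" where
  "thread a = fst (snd a)"

definition kind :: "('i, 'x) action \<Rightarrow> 'x kind" where
  "kind a = snd (snd a)"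

fun is_request :: "'x kind \<Rightarrow> bool" where
  "is_request BeginTx = True"
| "is_request TryCommit = True"
| "is_request (WriteReq x v) = True"
| "is_request (ReadReq x) = True"
| "is_request _ = False"

fun is_access_request :: "'x kind \<Rightarrow> bool" where
  "is_access_request (WriteReq x v) = True"
| "is_access_request (ReadReq x) = True"
| "is_access_request _ = False"

fun matches :: "'x kind \<Rightarrow> 'x kind \<Rightarrow> bool" where
  "matches BeginTx r \<longleftrightarrow> r = OkResp \<or> r = Aborted"
| "matches TryCommit r \<longleftrightarrow> r = Committed \<or> r = Aborted"
| "matches (WriteReq x v) r \<longleftrightarrow> r = RetUnit \<or> r = Aborted"
| "matches (ReadReq x) r \<longleftrightarrow> (\<exists>v. r = RetVal v) \<or> r = Aborted"
| "matches _ r \<longleftrightarrow> False"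

definition proj :: "nat \<Rightarrow> ('i, 'x) history \<Rightarrow> ('i, 'x) history" where
  "proj t H = filter (\<lambda>a. thread a = t) H"

definition before :: "('i, 'x) history \<Rightarrow> ('i, 'x) action \<Rightarrow> ('i, 'x) action \<Rightarrow> bool" where
  "before H a b \<longleftrightarrow> (\<exists>i j. i < j \<and> j < length H \<and> H ! i = a \<and> H ! j = b)"

text \<open>
  Identifiers are pairwise distinct in a history, so a subsequence is represented by the list of
  its actions, and an action by its value rather than by its position.
  The ``maximal subsequence of actions of one thread'' in the notion of a transaction
  is a maximal contiguous block of the projection to that thread. (Subsequences that skip
  actions must not count: they could drop a \<open>Committed\<close> and fuse two transactions.)
\<close>

definition tx_block :: "('i, 'x) action list \<Rightarrow> bool" where
  "tx_block T \<longleftrightarrow> T \<noteq> [] \<and> kind (hd T) = BeginTx \<and>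
     (\<forall>a \<in> set (butlast T). kind a \<noteq> Committed \<and> kind a \<noteq> Aborted)"

definition thread_transaction :: "('i, 'x) history \<Rightarrow> nat \<Rightarrow> ('i, 'x) action list \<Rightarrow> bool" where
  "thread_transaction H t T \<longleftrightarrow> sublist T (proj t H) \<and> tx_block T \<and>
     (\<forall>T'. sublist T' (proj t H) \<and> tx_block T' \<and> sublist T T' \<longrightarrow> T' = T)"

definition transaction :: "('i, 'x) history \<Rightarrow> ('i, 'x) action list \<Rightarrow> bool" where
  "transaction H T \<longleftrightarrow> (\<exists>t. thread_transaction H t T)"

definition committed_tx :: "('i, 'x) action list \<Rightarrow> bool" where
  "committed_tx T \<longleftrightarrow> kind (last T) = Committed"

definition aborted_tx :: "('i, 'x) action list \<Rightarrow> bool" where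
  "aborted_tx T \<longleftrightarrow> kind (last T) = Aborted"

definition commit_pending_tx :: "('i, 'x) action list \<Rightarrow> bool" where
  "commit_pending_tx T \<longleftrightarrow> kind (last T) = TryCommit"

definition live_tx :: "('i, 'x) action list \<Rightarrow> bool" where
  "live_tx T \<longleftrightarrow> \<not> committed_tx T \<and> \<not> aborted_tx T \<and> \<not> commit_pending_tx T"

definition history :: "nat \<Rightarrow> ('i, 'x) history \<Rightarrow> bool" where
  "history N H \<longleftrightarrow>
     (\<forall>a \<in> set H. thread a \<in> {1..N}) \<and>
     distinct (map ident H) \<and>
     (\<forall>t. let P = proj t H in \<forall>i < length P.
        (if even i then is_request (kind (P ! i))
         else matches (kind (P ! (i - 1))) (kind (P ! i)))) \<and>
     (\<forall>t. let B = filter (\<lambda>k. k = BeginTx \<or> k = Committed \<or> k = Aborted) (map kind (proj t H))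
        in \<forall>i < length B. even i \<longleftrightarrow> B ! i = BeginTx) \<and>
     (\<forall>a \<in> set H. kind a = TryCommit \<longrightarrow> (\<exists>T. transaction H T \<and> a \<in> set T)) \<and>
     (\<forall>i < length H. is_access_request (kind (H ! i)) \<and>
        (\<forall>T. thread_transaction (take i H) (thread (H ! i)) T \<longrightarrow>
               committed_tx T \<or> aborted_tx T) \<longrightarrow>
        Suc i < length H \<and> thread (H ! Suc i) = thread (H ! i) \<and>
        matches (kind (H ! i)) (kind (H ! Suc i)) \<and> kind (H ! Suc i) \<noteq> Aborted)"

definition nontx :: "('i, 'x) history \<Rightarrow> ('i, 'x) action \<Rightarrow> bool" where
  "nontx H a \<longleftrightarrow> a \<in> set H \<and> \<not> (\<exists>T. transaction H T \<and> a \<in> set T)"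

definition responds :: "('i, 'x) history \<Rightarrow> ('i, 'x) action \<Rightarrow> ('i, 'x) action \<Rightarrow> bool" where
  "responds H q r \<longleftrightarrow> sublist [q, r] (proj (thread q) H) \<and> matches (kind q) (kind r)"

definition nontx_access :: "('i, 'x) history \<Rightarrow> ('i, 'x) action list \<Rightarrow> bool" where
  "nontx_access H A \<longleftrightarrow> (\<exists>q r. A = [q, r] \<and> is_access_request (kind q) \<and> responds H q r \<and>
     nontx H q \<and> nontx H r)"

definition transactional_memory :: "nat \<Rightarrow> ('i, 'x) history set \<Rightarrow> bool" where
  "transactional_memory N TM \<longleftrightarrow>
     (\<forall>H \<in> TM. history N H) \<and>
     (\<forall>H \<in> TM. \<forall>H'. prefix H' H \<and> history N H' \<longrightarrow> H' \<in> TM) \<and>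
     (\<forall>H \<in> TM. \<forall>a. is_request (kind a) \<and> history N (H @ [a]) \<longrightarrow> H @ [a] \<in> TM)"

definition reads :: "('i, 'x) history \<Rightarrow> ('i, 'x) action \<Rightarrow> ('i, 'x) action \<Rightarrow> 'x \<Rightarrow> int \<Rightarrow> bool" where
  "reads H q r x v \<longleftrightarrow> responds H q r \<and> kind q = ReadReq x \<and> kind r = RetVal v"

definition writes_to :: "'x \<Rightarrow> ('i, 'x) action \<Rightarrow> bool" where
  "writes_to x w \<longleftrightarrow> (\<exists>v. kind w = WriteReq x v)"

definition non_interleaved :: "('i, 'x) history \<Rightarrow> bool" where
  "non_interleaved H \<longleftrightarrow>
     (\<forall>T \<nu>. transaction H T \<and> (transaction H \<nu> \<or> nontx_access H \<nu>) \<and> \<nu> \<noteq> T \<longrightarrow>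
        (\<forall>a \<in> set T. \<forall>b \<in> set \<nu>. before H a b) \<or>
        (\<forall>a \<in> set T. \<forall>b \<in> set \<nu>. before H b a))"

definition completion :: "nat \<Rightarrow> ('i, 'x) history \<Rightarrow> ('i, 'x) history \<Rightarrow> bool" where
  "completion N H Hc \<longleftrightarrow> history N Hc \<and> non_interleaved Hc \<and>
     (\<forall>T. transaction Hc T \<longrightarrow> \<not> commit_pending_tx T) \<and>
     subseq H Hc \<and>
     (\<forall>a \<in> set Hc - set H. kind a = Committed \<or> kind a = Aborted)"

definition eligible_write ::
  "('i, 'x) history \<Rightarrow> ('i, 'x) action \<Rightarrow> 'x \<Rightarrow> ('i, 'x) action \<Rightarrow> bool" where
  "eligible_write H r x w \<longleftrightarrow> writes_to x w \<and> before H w r \<and>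
     \<not> (\<exists>T. transaction H T \<and> (aborted_tx T \<or> live_tx T) \<and> w \<in> set T \<and> r \<notin> set T)"

definition legal :: "int \<Rightarrow> ('i, 'x) history \<Rightarrow> bool" where
  "legal vinit H \<longleftrightarrow> (\<forall>q r x v. reads H q r x v \<longrightarrow>
     (\<exists>w. eligible_write H r x w \<and> kind w = WriteReq x v \<and>
          (\<forall>w'. eligible_write H r x w' \<and> w' \<noteq> w \<longrightarrow> before H w' w)) \<or>
     ((\<nexists>w. eligible_write H r x w) \<and> v = vinit))"

definition H_atomic :: "nat \<Rightarrow> int \<Rightarrow> ('i, 'x) history set" where
  "H_atomic N vinit = {H. history N H \<and> non_interleaved H \<and>
     (\<exists>Hc. completion N H Hc \<and> legal vinit Hc)}"

definition po :: "('i, 'x) history \<Rightarrow> ('i, 'x) action \<Rightarrow> ('i, 'x) action \<Rightarrow> bool" where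
  "po H a b \<longleftrightarrow> before H a b \<and> thread a = thread b"

definition cl :: "('i, 'x) history \<Rightarrow> ('i, 'x) action \<Rightarrow> ('i, 'x) action \<Rightarrow> bool" where
  "cl H a b \<longleftrightarrow> before H a b \<and> nontx H a \<and> nontx H b"

definition corresponds :: "('i, 'x) history \<Rightarrow> ('i, 'x) history \<Rightarrow> bool" (infix "\<sqsubseteq>\<^sub>H" 50) where
  "H1 \<sqsubseteq>\<^sub>H H2 \<longleftrightarrow> (\<exists>\<theta>. bij_betw \<theta> {..<length H1} {..<length H2} \<and>
     (\<forall>i < length H1. H1 ! i = H2 ! \<theta> i) \<and>
     (\<forall>i j. i < j \<and> j < length H1 \<and> (po H1 (H1 ! i) (H1 ! j) \<or> cl H1 (H1 ! i) (H1 ! j)) \<longrightarrow>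
        \<theta> i < \<theta> j))"

definition local_read :: "('i, 'x) history \<Rightarrow> ('i, 'x) action \<Rightarrow> 'x \<Rightarrow> ('i, 'x) action list \<Rightarrow> bool" where
  "local_read H q x T \<longleftrightarrow> transaction H T \<and> q \<in> set T \<and>
     (\<exists>w \<in> set T. writes_to x w \<and> before H w q)"

definition local_write :: "('i, 'x) history \<Rightarrow> ('i, 'x) action \<Rightarrow> 'x \<Rightarrow> ('i, 'x) action list \<Rightarrow> bool" where
  "local_write H w x T \<longleftrightarrow> transaction H T \<and> w \<in> set T \<and>
     (\<exists>w' \<in> set T. writes_to x w' \<and> before H w w')"

definition nonlocal_write :: "('i, 'x) history \<Rightarrow> ('i, 'x) action \<Rightarrow> 'x \<Rightarrow> int \<Rightarrow> bool" where
  "nonlocal_write H w x v \<longleftrightarrow> w \<in> set H \<and> kind w = WriteReq x v \<and> \<not> (\<exists>T. local_write H w x T)"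

definition nonlocal_read ::
  "('i, 'x) history \<Rightarrow> ('i, 'x) action \<Rightarrow> ('i, 'x) action \<Rightarrow> 'x \<Rightarrow> int \<Rightarrow> bool" where
  "nonlocal_read H q r x v \<longleftrightarrow> reads H q r x v \<and> \<not> (\<exists>T. local_read H q x T)"

definition readable_write :: "('i, 'x) history \<Rightarrow> 'x \<Rightarrow> int \<Rightarrow> bool" where
  "readable_write H x v \<longleftrightarrow> (\<exists>w. nonlocal_write H w x v \<and>
     \<not> (\<exists>T. transaction H T \<and> (aborted_tx T \<or> live_tx T) \<and> w \<in> set T))"

definition cons :: "int \<Rightarrow> ('i, 'x) history \<Rightarrow> bool" where
  "cons vinit H \<longleftrightarrow>
     (\<forall>q r x v T. reads H q r x v \<and> local_read H q x T \<longrightarrow>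
        (\<exists>w \<in> set T. kind w = WriteReq x v \<and> before H w q \<and>
           (\<forall>w' \<in> set T. writes_to x w' \<and> before H w' q \<and> w' \<noteq> w \<longrightarrow> before H w' w))) \<and>
     (\<forall>q r x v. nonlocal_read H q r x v \<longrightarrow>
        readable_write H x v \<or> (\<not> readable_write H x v \<and> v = vinit))"

type_synonym ('i, 'x) node = "('i, 'x) action list"

record ('i, 'x) opgraph =
  verts :: "('i, 'x) node set"
  vis :: "('i, 'x) node set"
  WR :: "'x \<Rightarrow> ('i, 'x) node rel"
  WW :: "'x \<Rightarrow> ('i, 'x) node rel"
  RW :: "'x \<Rightarrow> ('i, 'x) node rel"
  PO :: "('i, 'x) node rel"
  CL :: "('i, 'x) node rel"

definition node_writes :: "'x \<Rightarrow> int \<Rightarrow> ('i, 'x) node \<Rightarrow> bool" where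
  "node_writes x v \<nu> \<longleftrightarrow> (\<exists>w \<in> set \<nu>. kind w = WriteReq x v)"

definition node_reads :: "('i, 'x) history \<Rightarrow> 'x \<Rightarrow> int \<Rightarrow> ('i, 'x) node \<Rightarrow> bool" where
  "node_reads H x v \<nu> \<longleftrightarrow> (\<exists>q r. reads H q r x v \<and> q \<in> set \<nu> \<and> r \<in> set \<nu>)"

definition visible_writers :: "('i, 'x) opgraph \<Rightarrow> 'x \<Rightarrow> ('i, 'x) node set" where
  "visible_writers G x = {\<nu> \<in> verts G. \<nu> \<in> vis G \<and> (\<exists>v. node_writes x v \<nu>)}"

definition wf_nodes :: "('i, 'x) history \<Rightarrow> ('i, 'x) opgraph \<Rightarrow> bool" where
  "wf_nodes H G \<longleftrightarrow>
     verts G = {T. transaction H T} \<union> {A. nontx_access H A} \<and>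
     vis G \<subseteq> verts G \<and>
     (\<forall>A. nontx_access H A \<longrightarrow> A \<in> vis G) \<and>
     (\<forall>T. transaction H T \<and> committed_tx T \<longrightarrow> T \<in> vis G) \<and>
     (\<forall>T. transaction H T \<and> (aborted_tx T \<or> live_tx T) \<longrightarrow> T \<notin> vis G)"

definition wf_WR :: "('i, 'x) history \<Rightarrow> ('i, 'x) opgraph \<Rightarrow> bool" where
  "wf_WR H G \<longleftrightarrow> (\<forall>x.
     WR G x \<subseteq> verts G \<times> verts G \<and>
     (\<forall>\<nu> \<nu>'. (\<nu>, \<nu>') \<in> WR G x \<longrightarrow>
        \<nu> \<noteq> \<nu>' \<and> \<nu> \<in> vis G \<and> (\<exists>v. node_writes x v \<nu> \<and> node_reads H x v \<nu>')) \<and>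
     (\<forall>\<nu>1 \<nu>2 \<nu>'. (\<nu>1, \<nu>') \<in> WR G x \<and> (\<nu>2, \<nu>') \<in> WR G x \<longrightarrow> \<nu>1 = \<nu>2))"

text \<open>
  \<open>WR\<close> is the reads-from relation: the non-local write that consistency provides for a non-local
  read of a value other than \<open>vinit\<close> is the one that the \<open>WR\<close>-predecessor of the reading node
  performs. \<open>wf_WR\<close> alone does not say this and would admit the empty relation; then the
  one-thread non-transactional history ``write \<open>x\<close> \<open>a\<close>; write \<open>x\<close> \<open>b\<close>; read \<open>x\<close> returning \<open>a\<close>'',
  with \<open>a\<close>, \<open>b\<close>, \<open>vinit\<close> distinct, would be consistent and have an acyclic graph, although it
  corresponds to no atomic history. For \<open>vinit\<close> no source is demanded, since \<open>RW\<close> orders a node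
  reading it before all other visible writers.
\<close>

definition WR_serves_reads :: "int \<Rightarrow> ('i, 'x) history \<Rightarrow> ('i, 'x) opgraph \<Rightarrow> bool" where
  "WR_serves_reads vinit H G \<longleftrightarrow> (\<forall>x. \<forall>\<nu>' \<in> verts G. \<forall>q r v.
     nonlocal_read H q r x v \<and> q \<in> set \<nu>' \<and> r \<in> set \<nu>' \<and> v \<noteq> vinit \<longrightarrow>
     (\<exists>\<nu> w. (\<nu>, \<nu>') \<in> WR G x \<and> w \<in> set \<nu> \<and> nonlocal_write H w x v))"

definition wf_WW :: "('i, 'x) opgraph \<Rightarrow> bool" where
  "wf_WW G \<longleftrightarrow> (\<forall>x. WW G x \<subseteq> visible_writers G x \<times> visible_writers G x \<and>
     strict_linear_order_on (visible_writers G x) (WW G x))"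

definition wf_RW :: "int \<Rightarrow> ('i, 'x) history \<Rightarrow> ('i, 'x) opgraph \<Rightarrow> bool" where
  "wf_RW vinit H G \<longleftrightarrow> (\<forall>x. RW G x = {(\<nu>, \<nu>'). \<nu> \<in> verts G \<and> \<nu>' \<in> verts G \<and> \<nu> \<noteq> \<nu>' \<and>
     ((\<exists>\<nu>''. (\<nu>'', \<nu>') \<in> WW G x \<and> (\<nu>'', \<nu>) \<in> WR G x) \<or>
      (\<nu>' \<in> visible_writers G x \<and> node_reads H x vinit \<nu>))})"

definition wf_PO_CL :: "('i, 'x) history \<Rightarrow> ('i, 'x) opgraph \<Rightarrow> bool" where
  "wf_PO_CL H G \<longleftrightarrow>
     PO G = {(\<nu>, \<nu>'). \<nu> \<in> verts G \<and> \<nu>' \<in> verts G \<and> \<nu> \<noteq> \<nu>' \<and>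
               (\<exists>a \<in> set \<nu>. \<exists>a' \<in> set \<nu>'. po H a a')} \<and>
     CL G = {(\<nu>, \<nu>'). \<nu> \<in> verts G \<and> \<nu>' \<in> verts G \<and> \<nu> \<noteq> \<nu>' \<and>
               (\<exists>a \<in> set \<nu>. \<exists>a' \<in> set \<nu>'. cl H a a')}"

definition Graph :: "int \<Rightarrow> ('i, 'x) history \<Rightarrow> ('i, 'x) opgraph set" where
  "Graph vinit H = {G. wf_nodes H G \<and> wf_WR H G \<and> WR_serves_reads vinit H G \<and>
     wf_WW G \<and> wf_RW vinit H G \<and> wf_PO_CL H G}"

definition edges :: "('i, 'x) opgraph \<Rightarrow> ('i, 'x) node rel" where
  "edges G = (\<Union>x. WR G x \<union> WW G x \<union> RW G x) \<union> PO G \<union> CL G"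

definition acyclic_graph :: "('i, 'x) opgraph \<Rightarrow> bool" where
  "acyclic_graph G \<longleftrightarrow> acyclic (edges G)"

end

theory Submission
  imports Defs
begin

text \<open>
  The nodes of an opacity graph partition the actions of a history. Given an acyclic graph of
  \<open>H\<close>, rank the nodes topologically and let \<open>S\<close> be the stable sort of \<open>H\<close> by the rank of the node of
  an action: the nodes become contiguous, and the \<open>PO\<close> and \<open>CL\<close> edges make the sort respect program
  order and the order of non-transactional actions. To complete \<open>S\<close>, append to \<open>H\<close> a response to every
  commit-pending transaction, \<open>Committed\<close> precisely for the visible ones, and sort again with the
  response ranked like its transaction. In this completion the writes that a non-local read can
  see are those of the visible nodes ranked below it. A visible writer placed between
  the \<open>WR\<close>-source and the reader would lie \<open>WW\<close>-above the source, hence \<open>RW\<close>-above the reader;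
  for a read of \<open>vinit\<close> every other visible writer is \<open>RW\<close>-above the reader.
\<close>

section \<open>Order of occurrence in a list\<close>

text \<open>Histories over the same actions with equal thread projections have the same
  transactions, non-transactional accesses and responses, so a sort that fixes every projection
  keeps the nodes. Apart from projections, \<open>history\<close> restricts the interleaving of
  threads in one clause only: a non-transactional request is followed at once by its response. For
  the sorted list this rests on the rank being injective, since then no foreign action shares the
  key of an access. The responses are inserted into \<open>H\<close> and not into the sorted list
  because the completion is then again a history sorted by node ranks, and one argument covers both
  lists. Much of the combinatorics comes from transactions being maximal blocks: the alternation of
  begin and final actions is what makes them disjoint. Consistency settles the local reads, whose
  writes keep the order of their thread; the graph settles the non-local ones.\<close>

lemma before_Nil [simp]: "\<not> before [] a b"
  by (simp add: before_def)

text \<open>Turns the positional definition into a recursion on the list, so that the facts below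
  follow by induction and simplification.\<close>

lemma before_Cons [simp]: "before (x # xs) a b \<longleftrightarrow> a = x \<and> b \<in> set xs \<or> before xs a b"
proof
  assume "before (x # xs) a b"
  then obtain i j where ij: "i < j" "j < Suc (length xs)" "(x # xs) ! i = a" "(x # xs) ! j = b"
    by (auto simp: before_def)
  then obtain j' where j': "j = Suc j'" by (cases j) auto
  show "a = x \<and> b \<in> set xs \<or> before xs a b"
  proof (cases i)
    case 0
    with ij j' show ?thesis by auto
  next
    case (Suc i')
    with ij j' show ?thesis unfolding before_def by auto
  qed
next
  assume "a = x \<and> b \<in> set xs \<or> before xs a b"
  then show "before (x # xs) a b"
  proof
    assume "a = x \<and> b \<in> set xs"
    then obtain j where "j < length xs" "xs ! j = b" "a = x" by (auto simp: in_set_conv_nth)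
    then show ?thesis unfolding before_def by (intro exI[of _ 0] exI[of _ "Suc j"]) auto
  next
    assume "before xs a b"
    then obtain i j where "i < j" "j < length xs" "xs ! i = a" "xs ! j = b"
      by (auto simp: before_def)
    then show ?thesis unfolding before_def by (intro exI[of _ "Suc i"] exI[of _ "Suc j"]) auto
  qed
qed

lemma before_append [simp]:
  "before (xs @ ys) a b \<longleftrightarrow> before xs a b \<or> before ys a b \<or> a \<in> set xs \<and> b \<in> set ys"
  by (induction xs) auto

lemma before_in_set: "before xs a b \<Longrightarrow> a \<in> set xs \<and> b \<in> set xs"
  by (induction xs) auto

lemma before_filter: "before (filter p xs) a b \<longleftrightarrow> before xs a b \<and> p a \<and> p b"
  by (induction xs) (auto dest: before_in_set)

lemma before_proj: "before (proj t H) a b \<longleftrightarrow> before H a b \<and> thread a = t \<and> thread b = t"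
  unfolding proj_def by (simp add: before_filter)

lemma before_asym: "distinct xs \<Longrightarrow> before xs a b \<Longrightarrow> \<not> before xs b a"
  by (induction xs) (auto dest: before_in_set)

lemma before_irrefl: "distinct xs \<Longrightarrow> \<not> before xs a a"
  using before_asym by blast

lemma before_total: "a \<in> set xs \<Longrightarrow> b \<in> set xs \<Longrightarrow> a \<noteq> b \<Longrightarrow> before xs a b \<or> before xs b a"
  by (induction xs) auto

lemma before_nth: "distinct xs \<Longrightarrow> before xs (xs ! i) (xs ! j) \<Longrightarrow> i < length xs \<Longrightarrow> j < length xs \<Longrightarrow> i < j"
  by (rule ccontr) (use before_asym[of xs "xs ! i" "xs ! j"] before_irrefl[of xs "xs ! i"]
    in \<open>auto simp: before_def not_less nat_less_le nth_eq_iff_index_eq\<close>)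

lemma before_sorted_le: "sorted (map f xs) \<Longrightarrow> before xs a b \<Longrightarrow> f a \<le> f b"
  by (induction xs) auto

lemma before_sorted_less:
  fixes f :: "_ \<Rightarrow> nat"
  shows "sorted (map f xs) \<Longrightarrow> a \<in> set xs \<Longrightarrow> b \<in> set xs \<Longrightarrow> f a < f b \<Longrightarrow> before xs a b"
  by (metis before_sorted_le before_total less_irrefl not_less)

text \<open>The device for aligning two decompositions of one projection, for example around a
  transaction and around a request with its response: a shared action fixes both sides.\<close>

lemma distinct_middle_unique:
  assumes "us @ x # vs = us' @ x # vs'" "distinct (us @ x # vs)"
  shows "us = us' \<and> vs = vs'"
  using assms
proof (induction us arbitrary: us')
  case Nil
  then show ?case by (cases us') auto
next
  case (Cons u us)
  then show ?case by (cases us') auto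
qed

lemma insort_key_cong:
  "\<forall>y \<in> insert x (set ys). f y = g y \<Longrightarrow> insort_key f x ys = insort_key g x ys"
  by (induction ys) auto

lemma sort_key_cong: "\<forall>x \<in> set xs. f x = g x \<Longrightarrow> sort_key f xs = sort_key g xs"
  by (induction xs) (auto intro!: insort_key_cong)

lemma sorted_beforeI: "(\<And>a b. before xs a b \<Longrightarrow> f a \<le> f b) \<Longrightarrow> sorted (map f xs)"
proof (induction xs)
  case (Cons x xs)
  have "f a \<le> f b" if "before xs a b" for a b using Cons.prems[of a b] that by simp
  then have "sorted (map f xs)" by (rule Cons.IH)
  moreover have "f x \<le> f b" if "b \<in> set xs" for b using Cons.prems[of x b] that by simp
  ultimately show ?case by simp
qed simp

text \<open>The induction removes an \<open>E\<close>-maximal element and ranks it on top.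
  Injectivity is demanded as well, so that unrelated nodes never tie when actions are
  sorted.\<close>

lemma topological_rank:
  assumes "finite V" "acyclic E"
  shows "\<exists>rk :: 'a \<Rightarrow> nat. inj_on rk V \<and> (\<forall>u \<in> V. \<forall>v \<in> V. (u, v) \<in> E \<longrightarrow> rk u < rk v)"
  using assms(1)
proof (induction V rule: finite_psubset_induct)
  case (psubset V)
  show ?case
  proof (cases "V = {}")
    case False
    let ?r = "E \<inter> V \<times> V"
    have "finite ?r" using psubset.hyps by simp
    moreover have "acyclic ?r" using assms(2) by (rule acyclic_subset) simp
    ultimately have "wf (?r\<inverse>)" by (rule finite_acyclic_wf_converse)
    \<comment> \<open>Well-foundedness of the converse on the finite restriction yields an element
      of \<open>V\<close> without successors in \<open>V\<close>.\<close>
    moreover obtain v0 where "v0 \<in> V" using False by blast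
    ultimately have "\<exists>m \<in> V. \<forall>y. (y, m) \<in> ?r\<inverse> \<longrightarrow> y \<notin> V"
      unfolding wf_eq_minimal by blast
    then obtain m where m: "m \<in> V" "\<And>y. y \<in> V \<Longrightarrow> (m, y) \<notin> E" by blast
    obtain rk :: "'a \<Rightarrow> nat" where rk: "inj_on rk (V - {m})"
      "\<forall>u \<in> V - {m}. \<forall>v \<in> V - {m}. (u, v) \<in> E \<longrightarrow> rk u < rk v"
      using psubset.IH[of "V - {m}"] m(1) by blast
    obtain n where n: "\<forall>k \<in> rk ` (V - {m}). k < n"
      using psubset.hyps finite_nat_set_iff_bounded[of "rk ` (V - {m})"] by auto
    let ?rk = "rk(m := n)"
    have "inj_on ?rk V"
    proof (rule inj_onI)
      fix u v assume "u \<in> V" "v \<in> V" "?rk u = ?rk v"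
      then show "u = v" using n inj_onD[OF rk(1), of u v] by (auto split: if_splits)
    qed
    moreover have "\<forall>u \<in> V. \<forall>v \<in> V. (u, v) \<in> E \<longrightarrow> ?rk u < ?rk v"
    proof (intro ballI impI)
      fix u v assume "u \<in> V" "v \<in> V" "(u, v) \<in> E"
      then show "?rk u < ?rk v" using rk(2) n m(2)[of v] by auto
    qed
    ultimately show ?thesis by blast
  qed auto
qed

section \<open>Transactions and non-transactional accesses\<close>

definition final :: "'x kind \<Rightarrow> bool" where
  "final k \<longleftrightarrow> k = Committed \<or> k = Aborted"

text \<open>The marker clause of \<open>history\<close>, detached from projections so that it can be
  applied to prefixes and to explicit decompositions.\<close>

definition alternating :: "('i, 'x) action list \<Rightarrow> bool" where
  "alternating P \<longleftrightarrow>
     (let B = filter (\<lambda>k. k = BeginTx \<or> k = Committed \<or> k = Aborted) (map kind P)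
      in \<forall>i < length B. even i \<longleftrightarrow> B ! i = BeginTx)"

lemma alternating_prefix:
  assumes "alternating (us @ vs)" shows "alternating us"
proof -
  let ?B = "\<lambda>P. filter (\<lambda>k. k = BeginTx \<or> k = Committed \<or> k = Aborted) (map kind P)"
  define Bu Bv where B: "Bu = ?B us" "Bv = ?B vs"
  have eq: "?B (us @ vs) = Bu @ Bv" by (simp add: B)
  have *: "even i \<longleftrightarrow> (Bu @ Bv) ! i = BeginTx" if "i < length (Bu @ Bv)" for i
    using assms that unfolding alternating_def Let_def eq by blast
  have "even i \<longleftrightarrow> Bu ! i = BeginTx" if "i < length Bu" for i
    using *[of i] that by (simp add: nth_append)
  then show ?thesis unfolding alternating_def Let_def B by blast
qed

text \<open>Without a final action in between, two begins would be neighbours among the markers, at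
  positions of opposite parity.\<close>

lemma alternating_begin_begin:
  assumes "alternating (us @ b # ms @ b' # vs)" "kind b = BeginTx" "kind b' = BeginTx"
  shows "\<exists>c \<in> set ms. final (kind c)"
proof (rule ccontr)
  assume neg: "\<not> ?thesis"
  let ?B = "\<lambda>P. filter (\<lambda>k. k = BeginTx \<or> k = Committed \<or> k = Aborted) (map kind P)"
  define Bu Bm Bv where B: "Bu = ?B us" "Bm = ?B ms" "Bv = ?B vs"
  have eq: "?B (us @ b # ms @ b' # vs) = Bu @ BeginTx # (Bm @ BeginTx # Bv)"
    using assms(2,3) by (simp add: B)
  \<comment> \<open>The marker directly after \<open>b\<close> is a begin in either case: one from
    \<open>ms\<close>, or \<open>b'\<close> if \<open>ms\<close> has no markers.\<close>
  have first: "(Bm @ BeginTx # Bv) ! 0 = BeginTx"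
  proof (cases Bm)
    case (Cons k ks)
    then have "k \<in> set (?B ms)" by (simp add: B)
    with neg have "k = BeginTx" by (auto simp: final_def)
    with Cons show ?thesis by simp
  qed simp
  have *: "even i \<longleftrightarrow> (Bu @ BeginTx # (Bm @ BeginTx # Bv)) ! i = BeginTx"
    if "i < length (Bu @ BeginTx # (Bm @ BeginTx # Bv))" for i
    using assms(1) that unfolding alternating_def Let_def eq by blast
  show False
    using *[of "length Bu"] *[of "Suc (length Bu)"] first by (simp add: nth_append)
qed

text \<open>A final marker has an odd position, so some marker precedes it immediately, at an even
  position, and that one is a begin. Everything from there to \<open>c\<close> forms a
  block.\<close>

lemma alternating_final:
  assumes "alternating (us @ c # vs)" "final (kind c)"
  obtains us1 b us2 where "us = us1 @ b # us2" "kind b = BeginTx"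
    "\<forall>a \<in> set us2. \<not> final (kind a)"
proof -
  let ?m = "\<lambda>a. kind a = BeginTx \<or> kind a = Committed \<or> kind a = Aborted"
  let ?B = "\<lambda>P. filter (\<lambda>k. k = BeginTx \<or> k = Committed \<or> k = Aborted) (map kind P)"
  define Bu Bv where B: "Bu = ?B us" "Bv = ?B vs"
  have eq: "?B (us @ c # vs) = Bu @ kind c # Bv"
    using assms(2) by (auto simp: final_def B)
  have *: "even i \<longleftrightarrow> (Bu @ kind c # Bv) ! i = BeginTx"
    if "i < length (Bu @ kind c # Bv)" for i
    using assms(1) that unfolding alternating_def Let_def eq by blast
  have odd: "odd (length Bu)"
    using *[of "length Bu"] assms(2) by (auto simp: final_def)
  then have "?B us \<noteq> []" unfolding B by force
  then have "\<exists>a \<in> set us. ?m a" by (auto simp: filter_empty_conv)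
  then obtain us1 b us2 where us: "us = us1 @ b # us2" "?m b" "\<forall>a \<in> set us2. \<not> ?m a"
    using split_list_last_prop[of us ?m] by blast
  define Bu1 where "Bu1 = ?B us1"
  have eq': "Bu = Bu1 @ [kind b]" using us by (auto simp: filter_empty_conv B Bu1_def)
  with odd have "even (length Bu1)" by simp
  then have "kind b = BeginTx" using *[of "length Bu1"] unfolding eq' by simp
  moreover have "\<forall>a \<in> set us2. \<not> final (kind a)" using us(3) by (auto simp: final_def)
  ultimately show thesis using that us(1) by blast
qed

section \<open>Transactions as maximal blocks of a projection\<close>

lemma tx_block_alt: "tx_block T \<longleftrightarrow> T \<noteq> [] \<and> kind (hd T) = BeginTx \<and>
     (\<forall>a \<in> set (butlast T). \<not> final (kind a))"
  by (auto simp: tx_block_def final_def)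

lemma tx_block_snoc: "tx_block T \<Longrightarrow> \<not> final (kind (last T)) \<Longrightarrow> tx_block (T @ [a])"
  unfolding tx_block_alt by (cases T rule: rev_cases) (auto simp: hd_append butlast_append split: if_splits)

lemma tx_block_prefix: "tx_block (T @ U) \<Longrightarrow> T \<noteq> [] \<Longrightarrow> tx_block T"
  unfolding tx_block_alt by (auto simp: butlast_append split: if_splits dest: in_set_butlastD)

text \<open>Replaces maximality by a condition on the right end alone. A block can grow to the right
  unless it ends in a final action or the projection stops. It can never grow to the left: the
  larger block would start with another begin, and alternation would put a final action in its
  interior.\<close>

lemma thread_transaction_iff:
  assumes "distinct (proj t H)" "alternating (proj t H)"
  shows "thread_transaction H t T \<longleftrightarrow>
    tx_block T \<and> (\<exists>us vs. proj t H = us @ T @ vs \<and> (vs = [] \<or> final (kind (last T))))"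
proof
  assume T: "thread_transaction H t T"
  note T' = T[unfolded thread_transaction_def]
  from T' have blk: "tx_block T" by (rule conjunct2[THEN conjunct1])
  from T' have max: "\<forall>T'. sublist T' (proj t H) \<and> tx_block T' \<and> sublist T T' \<longrightarrow> T' = T"
    by (rule conjunct2[THEN conjunct2])
  from T' have "sublist T (proj t H)" by (rule conjunct1)
  then obtain us vs where P: "proj t H = us @ T @ vs" unfolding sublist_def by blast
  have "final (kind (last T))" if ne: "vs \<noteq> []"
  proof (rule ccontr)
    assume nf: "\<not> final (kind (last T))"
    obtain v vs' where vs: "vs = v # vs'" using ne by (cases vs) auto
    have "proj t H = us @ (T @ [v]) @ vs'" using P vs by simp
    then have "sublist (T @ [v]) (proj t H)" by (simp only: sublist_appendI)
    moreover have "tx_block (T @ [v])" using blk nf by (rule tx_block_snoc)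
    moreover have "sublist T (T @ [v])" by (rule prefix_imp_sublist) simp
    ultimately have "T @ [v] = T" by (intro max[rule_format] conjI)
    then show False by simp
  qed
  then have "vs = [] \<or> final (kind (last T))" by auto
  with blk P show "tx_block T \<and> (\<exists>us vs. proj t H = us @ T @ vs \<and> (vs = [] \<or> final (kind (last T))))"
    by (intro conjI exI[of _ us] exI[of _ vs])
next
  assume R: "tx_block T \<and> (\<exists>us vs. proj t H = us @ T @ vs \<and> (vs = [] \<or> final (kind (last T))))"
  then obtain us vs where P: "proj t H = us @ T @ vs" and fin: "vs = [] \<or> final (kind (last T))"
    and blk: "tx_block T" by (elim conjE exE)
  obtain b T0 where T: "T = b # T0" and b: "kind b = BeginTx"
    using blk by (cases T) (auto simp: tx_block_def)
  have max: "T' = T" if sub: "sublist T' (proj t H)" and blk': "tx_block T'" and TT': "sublist T T'" for T'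
  proof -
    obtain as bs where T': "T' = as @ T @ bs" using TT' by (auto simp: sublist_def)
    obtain us' vs' where P': "proj t H = us' @ T' @ vs'" using sub by (auto simp: sublist_def)
    have "us @ b # (T0 @ vs) = (us' @ as) @ b # (T0 @ bs @ vs')" using P P' T T' by simp
    moreover have "distinct (us @ b # (T0 @ vs))" using assms(1) P T by simp
    ultimately have "T0 @ vs = T0 @ bs @ vs'" by (rule distinct_middle_unique[THEN conjunct2])
    then have vs: "vs = bs @ vs'" by simp
    have "bs = []"
    proof (rule ccontr)
      assume "bs \<noteq> []"
      then have "last T \<in> set (butlast T')" using T by (auto simp: T' butlast_append)
      moreover have "final (kind (last T))" using fin vs \<open>bs \<noteq> []\<close> by auto
      ultimately show False using blk' by (auto simp: tx_block_alt)
    qed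
    moreover have "as = []"
    proof (rule ccontr)
      assume "as \<noteq> []"
      then obtain b' as' where as: "as = b' # as'" by (cases as) auto
      have b': "kind b' = BeginTx" using blk' T' as by (simp add: tx_block_def)
      have "proj t H = us' @ b' # as' @ b # (T0 @ bs @ vs')" using P' T' as T by simp
      then have "alternating (us' @ b' # as' @ b # (T0 @ bs @ vs'))" using assms(2) by simp
      from alternating_begin_begin[OF this b' b]
      obtain c where "c \<in> set as'" "final (kind c)" by blast
      moreover have "set as' \<subseteq> set (butlast T')" using T' as T by (auto simp: butlast_append)
      ultimately show False using blk' by (auto simp: tx_block_alt)
    qed
    ultimately show ?thesis using T' by simp
  qed
  have "sublist T (proj t H)" unfolding P by simp
  with blk show "thread_transaction H t T"
    unfolding thread_transaction_def by (blast intro: max)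
qed

text \<open>Actions are absorbed greedily until the first final one or the end of the list; this
  produces the maximal block with a given beginning.\<close>

lemma tx_block_extend:
  "tx_block T \<Longrightarrow> \<exists>vs1 vs2. vs = vs1 @ vs2 \<and> tx_block (T @ vs1) \<and> (vs2 = [] \<or> final (kind (last (T @ vs1))))"
proof (induction vs arbitrary: T)
  case Nil
  then show ?case by (intro exI[of _ "[]"]) auto
next
  case (Cons v vs)
  show ?case
  proof (cases "final (kind (last T))")
    case True
    with Cons.prems show ?thesis by (intro exI[of _ "[]"] exI[of _ "v # vs"]) auto
  next
    case False
    then have "tx_block (T @ [v])" using Cons.prems by (simp add: tx_block_snoc)
    from Cons.IH[OF this] obtain vs1 vs2 where "vs = vs1 @ vs2" "tx_block ((T @ [v]) @ vs1)"
      "vs2 = [] \<or> final (kind (last ((T @ [v]) @ vs1)))" by blast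
    then show ?thesis by (intro exI[of _ "v # vs1"] exI[of _ vs2]) auto
  qed
qed

lemma thread_transaction_extend:
  assumes "distinct (proj t H)" "alternating (proj t H)"
    and "proj t H = us @ T @ vs" "tx_block T"
  obtains vs1 where "thread_transaction H t (T @ vs1)" "prefix vs1 vs"
proof -
  obtain vs1 vs2 where v: "vs = vs1 @ vs2" "tx_block (T @ vs1)"
    "vs2 = [] \<or> final (kind (last (T @ vs1)))" using tx_block_extend[OF assms(4)] by blast
  have "thread_transaction H t (T @ vs1)"
    unfolding thread_transaction_iff[OF assms(1,2)]
    using v assms(3) by (intro conjI exI[of _ us] exI[of _ vs2]) simp_all
  with v(1) that show thesis by auto
qed

text \<open>Aligned at the common action, the block that starts later would put a second begin
  inside the earlier one with no final action between them. So both start together and one is a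
  prefix of the other; a proper prefix would end in a final action, which a block tolerates only at
  its end.\<close>

lemma thread_transaction_inj:
  assumes "distinct (proj t H)" "alternating (proj t H)"
    and "thread_transaction H t T" "thread_transaction H t T'" "a \<in> set T" "a \<in> set T'"
  shows "T = T'"
proof -
  \<comment> \<open>The length condition breaks the symmetry; the claim is instantiated in both
    orders at the end.\<close>
  have main: "length us = length us' \<and> T = T'" 
    if "proj t H = us @ T @ vs" "vs = [] \<or> final (kind (last T))" "tx_block T"
      "proj t H = us' @ T' @ vs'" "vs' = [] \<or> final (kind (last T'))" "tx_block T'" 
      "a \<in> set T" "a \<in> set T'" "length us \<le> length us'"
    for us vs us' vs' T T'
  proof -
    have "\<exists>ds. us' = us @ ds \<and> T @ vs = ds @ T' @ vs'"
    proof -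
      have "us @ (T @ vs) = us' @ (T' @ vs')" using \<open>proj t H = us @ T @ vs\<close> \<open>proj t H = us' @ T' @ vs'\<close> by simp
      then obtain ds where "us = us' @ ds \<and> ds @ (T @ vs) = T' @ vs' \<or> us @ ds = us' \<and> T @ vs = ds @ (T' @ vs')"
        using iffD1[OF append_eq_append_conv2] by blast
      with \<open>length us \<le> length us'\<close> have "us' = us @ ds \<and> T @ vs = ds @ T' @ vs'" by auto
      then show ?thesis ..
    qed
    then obtain ds where us': "us' = us @ ds" and eq: "T @ vs = ds @ T' @ vs'" by blast
    obtain p q where T': "T' = p @ a # q" using \<open>a \<in> set T'\<close> by (meson split_list)
    obtain r s where T: "T = r @ a # s" using \<open>a \<in> set T\<close> by (meson split_list)
    have "(us @ r) @ a # (s @ vs) = (us' @ p) @ a # (q @ vs')" using that T T' by simp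
    moreover have "distinct ((us @ r) @ a # (s @ vs))" using assms(1) that(1) T by simp
    ultimately have "us @ r = us' @ p" by (rule distinct_middle_unique[THEN conjunct1])
    then have r: "r = ds @ p" using us' by simp
    have ds: "ds = []"
    proof (rule ccontr)
      assume "ds \<noteq> []"
      then obtain b ds' where d: "ds = b # ds'" by (cases ds) auto
      have b: "kind b = BeginTx" using \<open>tx_block T\<close> T r d by (simp add: tx_block_def)
      obtain b' T0 where T0: "T' = b' # T0" and b': "kind b' = BeginTx"
        using \<open>tx_block T'\<close> by (cases T') (auto simp: tx_block_def)
      have "proj t H = us @ b # ds' @ b' # (T0 @ vs')" using that(4) us' d T0 by simp
      then have "alternating (us @ b # ds' @ b' # (T0 @ vs'))" using assms(2) by simp
      from alternating_begin_begin[OF this b b']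
      obtain c where "c \<in> set ds'" "final (kind c)" by blast
      then show False using \<open>tx_block T\<close> T r d by (auto simp: tx_block_alt butlast_append)
    qed
    have eq2: "T @ vs = T' @ vs'" using eq ds by simp
    have no: "ws = []" if "tx_block (U @ ws)" "final (kind (last U))" "U \<noteq> []" for U ws
    proof (rule ccontr)
      assume "ws \<noteq> []"
      then have "last U \<in> set (butlast (U @ ws))" using that(3) by (auto simp: butlast_append)
      then show False using that by (auto simp: tx_block_alt)
    qed
    from eq2 obtain ws where "T = T' @ ws \<and> ws @ vs = vs' \<or> T @ ws = T' \<and> vs = ws @ vs'"
      using iffD1[OF append_eq_append_conv2] by blast
    then have "T = T'"
    proof
      assume w: "T = T' @ ws \<and> ws @ vs = vs'"
      show ?thesis
      proof (cases "vs' = []")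
        case False
        then have "final (kind (last T'))" using that(5) by simp
        then have "ws = []" using no[of T' ws] w \<open>tx_block T\<close> \<open>tx_block T'\<close> by (auto simp: tx_block_def)
        with w show ?thesis by simp
      qed (use w in simp)
    next
      assume w: "T @ ws = T' \<and> vs = ws @ vs'"
      show ?thesis
      proof (cases "vs = []")
        case False
        then have "final (kind (last T))" using that(2) by simp
        then have "ws = []" using no[of T ws] w \<open>tx_block T\<close> \<open>tx_block T'\<close> by (auto simp: tx_block_def)
        with w show ?thesis by simp
      qed (use w in simp)
    qed
    with us' ds show ?thesis by simp
  qed
  obtain us vs where 1: "proj t H = us @ T @ vs" "vs = [] \<or> final (kind (last T))" "tx_block T"
    using assms(3) unfolding thread_transaction_iff[OF assms(1,2)] by blast
  obtain us' vs' where 2: "proj t H = us' @ T' @ vs'" "vs' = [] \<or> final (kind (last T'))" "tx_block T'"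
    using assms(4) unfolding thread_transaction_iff[OF assms(1,2)] by blast
  show ?thesis
    using main[OF 1 2 assms(5,6)] main[OF 2 1 assms(6,5)] by (cases "length us \<le> length us'") auto
qed

section \<open>Histories seen through their thread projections\<close>

lemma history_threads: "history N H \<Longrightarrow> \<forall>a \<in> set H. thread a \<in> {1..N}"
  unfolding history_def by (elim conjE)

lemma history_idents: "history N H \<Longrightarrow> distinct (map ident H)"
  unfolding history_def by (elim conjE)

lemma history_requests: "history N H \<Longrightarrow> \<forall>t. let P = proj t H in \<forall>i < length P.
    (if even i then is_request (kind (P ! i)) else matches (kind (P ! (i - 1))) (kind (P ! i)))"
  unfolding history_def by (elim conjE)

lemma history_markers: "history N H \<Longrightarrow>
  \<forall>t. let B = filter (\<lambda>k. k = BeginTx \<or> k = Committed \<or> k = Aborted) (map kind (proj t H))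
    in \<forall>i < length B. even i \<longleftrightarrow> B ! i = BeginTx"
  unfolding history_def by (elim conjE)

lemma history_trycommit:
  "history N H \<Longrightarrow> \<forall>a \<in> set H. kind a = TryCommit \<longrightarrow> (\<exists>T. transaction H T \<and> a \<in> set T)"
  unfolding history_def by (elim conjE)

lemma history_nontx:
  "history N H \<Longrightarrow> \<forall>i < length H. is_access_request (kind (H ! i)) \<and>
      (\<forall>T. thread_transaction (take i H) (thread (H ! i)) T \<longrightarrow> committed_tx T \<or> aborted_tx T) \<longrightarrow>
      Suc i < length H \<and> thread (H ! Suc i) = thread (H ! i) \<and>
      matches (kind (H ! i)) (kind (H ! Suc i)) \<and> kind (H ! Suc i) \<noteq> Aborted"
  unfolding history_def by (elim conjE)

lemma history_distinct: "history N H \<Longrightarrow> distinct H"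
  unfolding history_def by (elim conjE) (simp only: distinct_map)

lemma history_distinct_proj: "history N H \<Longrightarrow> distinct (proj t H)"
  unfolding proj_def by (simp add: history_distinct)

lemma history_alternating: "history N H \<Longrightarrow> alternating (proj t H)"
  unfolding history_def alternating_def by (elim conjE) (rule spec[where x = t])

lemma history_request:
  assumes "history N H" "i < length (proj t H)"
  shows "if even i then is_request (kind (proj t H ! i))
    else matches (kind (proj t H ! (i - 1))) (kind (proj t H ! i))"
  using assms unfolding history_def Let_def by blast

lemma set_proj: "set (proj t H) = {a \<in> set H. thread a = t}"
  by (auto simp: proj_def)

lemma proj_append: "proj t (xs @ ys) = proj t xs @ proj t ys"
  by (simp add: proj_def)

lemma matches_request: "matches k r \<Longrightarrow> is_request k \<and> \<not> is_request r"
  by (cases k) auto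

lemma access_request: "is_access_request k \<Longrightarrow> is_request k \<and> k \<noteq> BeginTx \<and> k \<noteq> TryCommit \<and> \<not> final k"
  by (cases k) (auto simp: final_def)

lemma final_not_request: "final k \<Longrightarrow> \<not> is_request k"
  by (auto simp: final_def)

lemma responds_iff:
  "responds H q r \<longleftrightarrow> matches (kind q) (kind r) \<and> (\<exists>us vs. proj (thread q) H = us @ q # r # vs)"
  unfolding responds_def sublist_def by auto

lemma responds_in_set:
  assumes "responds H q r"
  shows "q \<in> set H" "r \<in> set H" "thread r = thread q"
proof -
  obtain us vs where P: "proj (thread q) H = us @ q # r # vs" using assms unfolding responds_iff by blast
  have "q \<in> set (proj (thread q) H)" "r \<in> set (proj (thread q) H)" unfolding P by simp_all
  then show "q \<in> set H" "r \<in> set H" "thread r = thread q" by (simp_all add: set_proj)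
qed

lemma response_predecessor:
  assumes "history N H" "proj t H = us @ a # vs" "\<not> is_request (kind a)"
  obtains us' q where "us = us' @ [q]" "matches (kind q) (kind a)"
proof -
  let ?i = "length us"
  have i: "?i < length (proj t H)" and a: "proj t H ! ?i = a" using assms(2) by simp_all
  have m: "odd ?i \<and> matches (kind (proj t H ! (?i - 1))) (kind a)"
    using history_request[OF assms(1) i] a assms(3) by (auto split: if_splits)
  then have "us \<noteq> []" by auto
  then obtain us' q where us: "us = us' @ [q]" by (cases us rule: rev_cases) auto
  then have "proj t H ! (?i - 1) = q" using assms(2) by simp
  with m us that show thesis by auto
qed

section \<open>The nodes partition the actions of a history\<close>

definition node :: "('i, 'x) history \<Rightarrow> ('i, 'x) node \<Rightarrow> bool" where
  "node H \<nu> \<longleftrightarrow> transaction H \<nu> \<or> nontx_access H \<nu>"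

lemma thread_transaction_set: "thread_transaction H t T \<Longrightarrow> set T \<subseteq> set (proj t H)"
  unfolding thread_transaction_def by (auto dest: set_mono_sublist)

lemma thread_transaction_nonempty: "thread_transaction H t T \<Longrightarrow> T \<noteq> []"
  by (simp add: thread_transaction_def tx_block_def)

lemma transaction_thread: "transaction H T \<Longrightarrow> a \<in> set T \<Longrightarrow> thread_transaction H (thread a) T"
  unfolding transaction_def using thread_transaction_set by (fastforce simp: set_proj)

lemma transaction_unique:
  assumes "history N H" "transaction H T" "transaction H T'" "a \<in> set T" "a \<in> set T'"
  shows "T = T'"
  using thread_transaction_inj[OF history_distinct_proj[OF assms(1)] history_alternating[OF assms(1)]]
    transaction_thread assms(2-) by blast

lemma thread_transaction_cases:
  assumes "history N H" "thread_transaction H t T"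
  obtains us vs where "proj t H = us @ T @ vs" "tx_block T" "vs = [] \<or> final (kind (last T))"
  using assms thread_transaction_iff[OF history_distinct_proj history_alternating] by metis

text \<open>A transaction stops only at a final action or at the end of the projection, and a
  request followed by \<open>r\<close> is neither.\<close>

lemma transaction_response:
  assumes "history N H" "thread_transaction H t T" "q \<in> set T"
    and P: "proj t H = us @ q # r # vs" and "is_request (kind q)"
  shows "r \<in> set T"
proof -
  obtain us' vs' where T: "proj t H = us' @ T @ vs'" "vs' = [] \<or> final (kind (last T))"
    using assms(1,2) by (rule thread_transaction_cases)
  obtain T1 T2 where T12: "T = T1 @ q # T2" using assms(3) by (meson split_list)
  have "us @ q # (r # vs) = (us' @ T1) @ q # (T2 @ vs')" using P T T12 by simp
  moreover have "distinct (us @ q # (r # vs))" using history_distinct_proj[OF assms(1)] P by metis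
  ultimately have eq: "r # vs = T2 @ vs'" by (rule distinct_middle_unique[THEN conjunct2])
  have "T2 \<noteq> []"
  proof
    assume "T2 = []"
    with eq have "vs' \<noteq> []" by auto
    with T(2) \<open>T2 = []\<close> T12 have "final (kind q)" by simp
    with assms(5) show False using final_not_request by blast
  qed
  with eq T12 show ?thesis by (cases T2) auto
qed

text \<open>Only the begin is first in its transaction, so any other action has its predecessor
  inside.\<close>

lemma transaction_predecessor:
  assumes "history N H" "thread_transaction H t T" "r \<in> set T"
    and P: "proj t H = us @ q # r # vs" and "kind r \<noteq> BeginTx"
  shows "q \<in> set T"
proof -
  obtain us' vs' where T: "proj t H = us' @ T @ vs'" "tx_block T"
    using assms(1,2) by (rule thread_transaction_cases)
  obtain T1 T2 where T12: "T = T1 @ r # T2" using assms(3) by (meson split_list)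
  have "(us @ [q]) @ r # vs = (us' @ T1) @ r # (T2 @ vs')" using P T T12 by simp
  moreover have "distinct ((us @ [q]) @ r # vs)" using history_distinct_proj[OF assms(1), of t] P by simp
  ultimately have eq: "us @ [q] = us' @ T1" by (rule distinct_middle_unique[THEN conjunct1])
  have "T1 \<noteq> []" using T(2) T12 assms(5) by (auto simp: tx_block_def)
  with eq T12 show ?thesis by (cases T1 rule: rev_cases) auto
qed

lemma block_in_transaction:
  assumes "history N H" "proj t H = us @ T @ vs" "tx_block T"
  obtains T' where "thread_transaction H t T'" "set T \<subseteq> set T'"
  using thread_transaction_extend[OF history_distinct_proj[OF assms(1)] history_alternating[OF assms(1)] assms(2,3)]
  by (metis Un_upper1 set_append)

text \<open>Links the two views of being outside transactions: \<open>nontx\<close> looks at the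
  whole history, whereas \<open>history\<close> looks at the transactions before the request. An
  unfinished transaction of the prefix absorbs \<open>q\<close>; conversely, the part before
  \<open>q\<close> of a transaction through \<open>q\<close> is unfinished in the prefix, and it is
  nonempty as \<open>q\<close> is not a begin.\<close>

lemma nontx_iff:
  assumes H: "history N H" "H = us @ q # vs" and k: "kind q \<noteq> BeginTx"
  shows "nontx H q \<longleftrightarrow> (\<forall>T. thread_transaction us (thread q) T \<longrightarrow> final (kind (last T)))"
proof -
  let ?t = "thread q"
  have P: "proj ?t H = proj ?t us @ q # proj ?t vs" using H(2) by (simp add: proj_def)
  have dP: "distinct (proj ?t us @ q # proj ?t vs)"
    using history_distinct_proj[OF H(1), of ?t] P by simp
  then have d: "distinct (proj ?t us)" by simp
  have a: "alternating (proj ?t us)"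
    using history_alternating[OF H(1), of ?t] P alternating_prefix by metis
  have "\<exists>T. transaction H T \<and> q \<in> set T"
    if T: "thread_transaction us ?t T" and nf: "\<not> final (kind (last T))" for T
  proof -
    \<comment> \<open>Not ending in a final action, \<open>T\<close> must reach the end of the
      projection, so that \<open>q\<close> comes right after it.\<close>
    obtain p where blk: "tx_block T" and p: "proj ?t us = p @ T"
      using T nf unfolding thread_transaction_iff[OF d a] by auto
    from blk nf have "tx_block (T @ [q])" by (rule tx_block_snoc)
    moreover have "proj ?t H = p @ (T @ [q]) @ proj ?t vs" using P p by simp
    ultimately obtain T' where "thread_transaction H ?t T'" "set (T @ [q]) \<subseteq> set T'"
      using block_in_transaction[OF H(1)] by metis
    then show ?thesis unfolding transaction_def by auto
  qed
  moreover have "\<exists>T. thread_transaction us ?t T \<and> \<not> final (kind (last T))"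
    if T: "transaction H T" and q: "q \<in> set T" for T
  proof -
    obtain us' vs' where T': "proj ?t H = us' @ T @ vs'" "tx_block T"
      using H(1) transaction_thread[OF T q] by (rule thread_transaction_cases)
    obtain T1 T2 where T12: "T = T1 @ q # T2" using q by (meson split_list)
    have "proj ?t us @ q # proj ?t vs = (us' @ T1) @ q # (T2 @ vs')" using P T' T12 by simp
    from this dP have us: "proj ?t us = us' @ T1" by (rule distinct_middle_unique[THEN conjunct1])
    have ne: "T1 \<noteq> []" using T'(2) T12 k by (auto simp: tx_block_def)
    have "tx_block T1" using T'(2) T12 ne tx_block_prefix by blast
    then have "thread_transaction us ?t T1"
      unfolding thread_transaction_iff[OF d a] using us by (intro conjI exI[of _ us'] exI[of _ "[]"]) simp_all
    moreover have "last T1 \<in> set (butlast T)" using T12 ne by (auto simp: butlast_append)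
    then have "\<not> final (kind (last T1))" using T'(2) by (auto simp: tx_block_alt)
    ultimately show ?thesis by blast
  qed
  ultimately show ?thesis unfolding nontx_def using H(2) by auto
qed

text \<open>The response is outside transactions too, because a transaction containing it would
  contain its predecessor \<open>q\<close>.\<close>

lemma nontx_request_response:
  assumes H: "history N H" "H = us @ q # vs" and k: "is_access_request (kind q)" and q: "nontx H q"
  obtains r vs' where "vs = r # vs'" "thread r = thread q" "matches (kind q) (kind r)"
    "kind r \<noteq> Aborted" "nontx_access H [q, r]"
proof -
  let ?i = "length us"
  have i: "?i < length H" "H ! ?i = q" "take ?i H = us" using H(2) by simp_all
  have "\<forall>T. thread_transaction us (thread q) T \<longrightarrow> committed_tx T \<or> aborted_tx T"
    using q nontx_iff[OF H] access_request[OF k]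
    unfolding final_def committed_tx_def aborted_tx_def by blast
  then have c: "is_access_request (kind (H ! ?i)) \<and> (\<forall>T. thread_transaction (take ?i H) (thread (H ! ?i)) T \<longrightarrow>
      committed_tx T \<or> aborted_tx T)" using i k by simp
  have "\<forall>i < length H. is_access_request (kind (H ! i)) \<and>
        (\<forall>T. thread_transaction (take i H) (thread (H ! i)) T \<longrightarrow>
               committed_tx T \<or> aborted_tx T) \<longrightarrow>
        Suc i < length H \<and> thread (H ! Suc i) = thread (H ! i) \<and>
        matches (kind (H ! i)) (kind (H ! Suc i)) \<and> kind (H ! Suc i) \<noteq> Aborted"
    using H(1) unfolding history_def by (elim conjE)
  from this[rule_format, OF i(1) c]
  have r: "Suc ?i < length H" "thread (H ! Suc ?i) = thread q" "matches (kind q) (kind (H ! Suc ?i))"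
    "kind (H ! Suc ?i) \<noteq> Aborted" using i(2) by auto
  obtain r vs' where vs: "vs = r # vs'" using r(1) H(2) by (cases vs) auto
  then have Hr: "H ! Suc ?i = r" using H(2) by (simp add: nth_append)
  have P: "proj (thread q) H = proj (thread q) us @ q # r # proj (thread q) vs'"
    using H(2) vs r(2) Hr by (simp add: proj_def)
  have nr: "nontx H r"
  proof -
    have "\<not> (transaction H T \<and> r \<in> set T)" for T
    proof
      assume T: "transaction H T \<and> r \<in> set T"
      have "kind r \<noteq> BeginTx" using matches_request r(3) Hr by force
      then have "q \<in> set T"
        using transaction_predecessor[OF H(1), of "thread q" T r] P T transaction_thread r(2) Hr by metis
      with T q show False unfolding nontx_def by blast
    qed
    then show ?thesis unfolding nontx_def using H(2) vs by auto
  qed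
  have "nontx_access H [q, r]"
    unfolding nontx_access_def using k q nr P r(3) Hr by (auto simp: responds_iff)
  with vs r Hr that show thesis by auto
qed

text \<open>The covering half of the partition. An action outside transactions is no begin, since a
  begin alone is a block, and no \<open>TryCommit\<close> by the clause of \<open>history\<close>.
  It is not final either, since alternation supplies a begin that it closes. What remains is an
  access request or a response to one.\<close>

lemma node_exists:
  assumes H: "history N H" and a: "a \<in> set H"
  obtains \<nu> where "node H \<nu>" "a \<in> set \<nu>"
proof (cases "nontx H a")
  case False
  with a that show thesis unfolding nontx_def node_def by blast
next
  case True
  let ?t = "thread a"
  obtain us vs where P: "proj ?t H = us @ a # vs"
    using a by (metis (mono_tags, lifting) mem_Collect_eq set_proj split_list)
  have blk: "a \<notin> set T" if "proj ?t H = us' @ T @ vs'" "tx_block T" for us' T vs'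
    using block_in_transaction[OF H that] True unfolding nontx_def transaction_def by blast
  \<comment> \<open>Treats both roles of \<open>a\<close> at once: \<open>q\<close> is
    \<open>a\<close> itself, or the request that \<open>a\<close> directly follows.\<close>
  have req: "\<exists>\<nu>. node H \<nu> \<and> a \<in> set \<nu>" if q: "proj ?t H = us' @ q # vs'" "nontx H q" "is_access_request (kind q)"
    "q = a \<or> (\<exists>vs''. vs' = a # vs'')" for us' q vs'
  proof -
    have "q \<in> set H" using q(2) by (simp add: nontx_def)
    then obtain us0 vs0 where H0: "H = us0 @ q # vs0" by (meson split_list)
    obtain r where r: "nontx_access H [q, r]"
      using nontx_request_response[OF H H0 q(3,2)] by metis
    then obtain us1 vs1 where 1: "proj (thread q) H = us1 @ q # r # vs1"
      unfolding nontx_access_def responds_iff by auto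
    have tq: "thread q = ?t" using q(1) set_proj[of ?t H] by auto
    have "us' @ q # vs' = us1 @ q # (r # vs1)" using 1 q(1) tq by simp
    moreover have "distinct (us' @ q # vs')" using history_distinct_proj[OF H, of ?t] q(1) by simp
    ultimately have "vs' = r # vs1" by (rule distinct_middle_unique[THEN conjunct2])
    with q(4) have "a \<in> set [q, r]" by auto
    with r show ?thesis unfolding node_def by blast
  qed
  have tc: "\<forall>a \<in> set H. kind a = TryCommit \<longrightarrow> (\<exists>T. transaction H T \<and> a \<in> set T)"
    using H unfolding history_def by (elim conjE)
  show thesis
  proof (cases "is_request (kind a)")
    case r: True
    have "kind a \<noteq> BeginTx" using blk[of us "[a]" vs] P by (auto simp: tx_block_def)
    moreover have "kind a \<noteq> TryCommit" using tc True unfolding nontx_def by blast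
    ultimately have "is_access_request (kind a)" using r by (cases "kind a") auto
    with req P True that show thesis by blast
  next
    case False
    have nf: "\<not> final (kind a)"
    proof
      assume f: "final (kind a)"
      have "alternating (us @ a # vs)" using history_alternating[OF H, of ?t] P by simp
      then obtain us1 b us2 where "us = us1 @ b # us2" "kind b = BeginTx" "\<forall>a \<in> set us2. \<not> final (kind a)"
        using f by (rule alternating_final)
      then show False using blk[of us1 "b # us2 @ [a]" vs] P
        by (auto simp: tx_block_alt butlast_append final_def)
    qed
    obtain us' q where us: "us = us' @ [q]" and m: "matches (kind q) (kind a)"
      using response_predecessor[OF H P False] .
    have P': "proj ?t H = us' @ q # (a # vs)" using P us by simp
    have tq: "thread q = ?t" "q \<in> set H" using P' set_proj[of ?t H] by auto
    have nq: "nontx H q"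
    proof -
      have "\<not> (transaction H T \<and> q \<in> set T)" for T
      proof
        assume T: "transaction H T \<and> q \<in> set T"
        then have "thread_transaction H ?t T" using transaction_thread tq by metis
        then have "a \<in> set T" using transaction_response[OF H _ _ P'] T m matches_request by blast
        with T True show False unfolding nontx_def by blast
      qed
      with tq show ?thesis unfolding nontx_def by blast
    qed
    have "kind q \<noteq> BeginTx" using blk[of us' "[q, a]" vs] P' by (auto simp: tx_block_def)
    moreover have "kind q \<noteq> TryCommit" using tc nq unfolding nontx_def by blast
    ultimately have "is_access_request (kind q)" using m by (cases "kind q") auto
    with req P' nq that show thesis by blast
  qed
qed

lemma nontx_access_unique:
  assumes H: "history N H" and A: "nontx_access H A" "nontx_access H A'" "a \<in> set A" "a \<in> set A'"
  shows "A = A'"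
proof -
  obtain q r where qr: "A = [q, r]" "matches (kind q) (kind r)" "responds H q r"
    using A(1) unfolding nontx_access_def responds_def by blast
  obtain q' r' where qr': "A' = [q', r']" "matches (kind q') (kind r')" "responds H q' r'"
    using A(2) unfolding nontx_access_def responds_def by blast
  obtain us vs where P: "proj (thread q) H = us @ q # r # vs" using qr(3) unfolding responds_iff by blast
  obtain us' vs' where P': "proj (thread q') H = us' @ q' # r' # vs'" using qr'(3) unfolding responds_iff by blast
  have t: "thread r = thread q" "thread r' = thread q'"
    using P P' set_proj[of "thread q" H] set_proj[of "thread q'" H] by auto
  have "q = q' \<or> r = r'" using A(3,4) qr(1,2) qr'(1,2) matches_request by auto
  then show ?thesis
  proof
    assume e: "q = q'"
    have "us @ q # (r # vs) = us' @ q # (r' # vs')" using P P' e by simp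
    moreover have "distinct (us @ q # (r # vs))" using history_distinct_proj[OF H, of "thread q"] P by simp
    ultimately have "r # vs = r' # vs'" by (rule distinct_middle_unique[THEN conjunct2])
    with e qr(1) qr'(1) show ?thesis by simp
  next
    assume e: "r = r'"
    have "(us @ [q]) @ r # vs = (us' @ [q']) @ r # vs'" using P P' e t by simp
    moreover have "distinct ((us @ [q]) @ r # vs)" using history_distinct_proj[OF H, of "thread q"] P by simp
    ultimately have "us @ [q] = us' @ [q']" by (rule distinct_middle_unique[THEN conjunct1])
    with e qr(1) qr'(1) show ?thesis by simp
  qed
qed

lemma node_unique:
  assumes H: "history N H" and "node H \<nu>" "node H \<nu>'" "a \<in> set \<nu>" "a \<in> set \<nu>'"
  shows "\<nu> = \<nu>'"
proof -
  have *: "\<not> (transaction H T \<and> nontx_access H A \<and> a \<in> set T \<and> a \<in> set A)" for T A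
    unfolding nontx_access_def nontx_def by auto
  from assms * nontx_access_unique[OF H] transaction_unique[OF H] show ?thesis
    unfolding node_def by blast
qed

lemma node_thread:
  assumes "node H \<nu>" "a \<in> set \<nu>" "b \<in> set \<nu>"
  shows "thread a = thread b" "a \<in> set H"
proof -
  obtain t where "set \<nu> \<subseteq> set (proj t H)"
  proof (cases "transaction H \<nu>")
    case True
    with that show thesis unfolding transaction_def using thread_transaction_set by blast
  next
    case False
    then obtain q r where "\<nu> = [q, r]" "responds H q r"
      using assms(1) unfolding node_def nontx_access_def by blast
    with that[of "thread q"] show thesis unfolding responds_iff by auto
  qed
  with assms(2,3) show "thread a = thread b" "a \<in> set H" by (auto simp: set_proj)
qed

lemma node_response:
  assumes H: "history N H" and "node H \<nu>" "q \<in> set \<nu>" "responds H q r"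
  shows "r \<in> set \<nu>"
proof (cases "transaction H \<nu>")
  case True
  obtain us vs where P: "proj (thread q) H = us @ q # r # vs" and "is_request (kind q)"
    using assms(4) matches_request unfolding responds_iff by blast
  with True assms(3) show ?thesis using transaction_response[OF H transaction_thread[OF True]] by blast
next
  case False
  then obtain q' r' where qr: "\<nu> = [q', r']" "responds H q' r'"
    using assms(2) unfolding node_def nontx_access_def by blast
  obtain us vs where P: "proj (thread q) H = us @ q # r # vs" "is_request (kind q)"
    using assms(4) matches_request unfolding responds_iff by blast
  obtain us' vs' where P': "proj (thread q') H = us' @ q' # r' # vs'" "\<not> is_request (kind r')"
    using qr(2) matches_request unfolding responds_iff by blast
  have e: "q = q'" using P(2) P'(2) qr(1) assms(3) by auto
  have "us @ q # (r # vs) = us' @ q # (r' # vs')" using P P' e by simp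
  moreover have "distinct (us @ q # (r # vs))" using history_distinct_proj[OF H, of "thread q"] P by simp
  ultimately have "r # vs = r' # vs'" by (rule distinct_middle_unique[THEN conjunct2])
  with qr show ?thesis by simp
qed

lemma node_nonempty: "node H \<nu> \<Longrightarrow> \<nu> \<noteq> []"
  unfolding node_def nontx_access_def transaction_def by (auto dest: thread_transaction_nonempty)

text \<open>Nodes are nonempty and pairwise disjoint, so the first action identifies a node.\<close>

lemma finite_nodes:
  assumes "history N H"
  shows "finite {\<nu>. node H \<nu>}"
proof (rule inj_on_finite)
  have hd: "hd \<nu> \<in> set \<nu>" if "node H \<nu>" for \<nu> using node_nonempty[OF that] by simp
  show "inj_on hd {\<nu>. node H \<nu>}"
  proof (rule inj_onI)
    fix \<nu> \<nu>' assume "\<nu> \<in> {\<nu>. node H \<nu>}" "\<nu>' \<in> {\<nu>. node H \<nu>}" "hd \<nu> = hd \<nu>'"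
    then show "\<nu> = \<nu>'" using node_unique[OF assms, of \<nu> \<nu>' "hd \<nu>"] hd[of \<nu>] hd[of \<nu>'] by simp
  qed
  show "hd ` {\<nu>. node H \<nu>} \<subseteq> set H" using hd node_thread(2) by blast
qed simp

text \<open>Needed because \<open>eligible_write\<close> compares a write with the response of a
  read, while \<open>cons\<close> and \<open>local_read\<close> compare it with the request. The two
  are adjacent in their thread.\<close>

lemma before_response_iff:
  assumes "history N H" "responds H q r" "thread w = thread q" "w \<noteq> q"
  shows "before H w r \<longleftrightarrow> before H w q"
proof -
  obtain us vs where P: "proj (thread q) H = us @ q # r # vs" using assms(2) unfolding responds_iff by blast
  have tr: "thread r = thread q" using responds_in_set(3)[OF assms(2)] .
  have d: "distinct (us @ q # r # vs)" using history_distinct_proj[OF assms(1), of "thread q"] P by simp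
  have "before (proj (thread q) H) w r \<longleftrightarrow> before (proj (thread q) H) w q"
    unfolding P using d assms(4) by (auto dest: before_in_set)
  then show ?thesis unfolding before_proj using assms(3) tr by simp
qed

section \<open>Sorting a history by the rank of its nodes\<close>

text \<open>This and the next congruences express that nodes and responses depend on a history
  through its projections alone.\<close>

lemma transaction_cong: "(\<And>t. proj t S = proj t H) \<Longrightarrow> transaction S = transaction H"
  unfolding transaction_def thread_transaction_def by simp

lemma set_cong_proj: "(\<And>t. proj t S = proj t H) \<Longrightarrow> set S = set H"
proof (rule set_eqI)
  fix a assume *: "\<And>t. proj t S = proj t H"
  have "a \<in> set S \<longleftrightarrow> a \<in> set (proj (thread a) S)" by (simp add: set_proj)
  also have "\<dots> \<longleftrightarrow> a \<in> set H" unfolding * by (simp add: set_proj)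
  finally show "a \<in> set S \<longleftrightarrow> a \<in> set H" .
qed

lemma nontx_cong: "(\<And>t. proj t S = proj t H) \<Longrightarrow> nontx S = nontx H"
  unfolding nontx_def using transaction_cong[of S H] set_cong_proj[of S H] by simp

lemma responds_cong: "(\<And>t. proj t S = proj t H) \<Longrightarrow> responds S = responds H"
  unfolding responds_def by simp

lemma nontx_access_cong: "(\<And>t. proj t S = proj t H) \<Longrightarrow> nontx_access S = nontx_access H"
  unfolding nontx_access_def using nontx_cong[of S H] responds_cong[of S H] by simp

text \<open>Monotonicity along each thread makes a stable sort preserve the projections; the last
  two assumptions say that the level sets of the key on the actions of \<open>H\<close> are exactly
  the nodes. The key stays abstract because it is instantiated twice, for \<open>H\<close> and for
  its extension by responses.\<close>

locale serialization =
  fixes N :: nat and H :: "('i, 'x) history" and f :: "('i, 'x) action \<Rightarrow> nat"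
  assumes history: "history N H"
    and mono: "sorted (map f (proj t H))"
    and node_const: "node H \<nu> \<Longrightarrow> a \<in> set \<nu> \<Longrightarrow> b \<in> set \<nu> \<Longrightarrow> f a = f b"
    and node_inj: "node H \<nu> \<Longrightarrow> node H \<nu>' \<Longrightarrow> a \<in> set \<nu> \<Longrightarrow> b \<in> set \<nu>' \<Longrightarrow> f a = f b \<Longrightarrow> \<nu> = \<nu>'"
begin

definition S :: "('i, 'x) history" where "S = sort_key f H"

lemma sorted_S: "sorted (map f S)"
  by (simp add: S_def)

text \<open>Filtering commutes with stable sorting, and each projection is already sorted.\<close>

lemma proj_S: "proj t S = proj t H"
  unfolding S_def proj_def filter_sort using mono[of t, unfolded proj_def]
  by (rule sort_key_id_if_sorted)

lemma set_S: "set S = set H"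
  by (simp add: S_def)

lemma distinct_S: "distinct S"
  using history_distinct[OF history] by (simp add: S_def)

lemma node_S: "node S = node H"
  unfolding node_def using transaction_cong[of S H] nontx_access_cong[of S H] proj_S by simp

lemma before_S_less: "a \<in> set H \<Longrightarrow> b \<in> set H \<Longrightarrow> f a < f b \<Longrightarrow> before S a b"
  using before_sorted_less[OF sorted_S] by (simp add: set_S)

lemma before_S_le: "before S a b \<Longrightarrow> f a \<le> f b"
  by (rule before_sorted_le[OF sorted_S])

lemma before_S_thread: "thread a = thread b \<Longrightarrow> before S a b \<longleftrightarrow> before H a b"
  using before_proj[of "thread a" S a b] before_proj[of "thread a" H a b] proj_S by simp

text \<open>An action between \<open>q\<close> and \<open>r\<close> has a key between two equal
  keys, hence belongs to the same two-element node.\<close>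

lemma nontx_pair_adjacent:
  assumes S: "S = us @ q # vs" and A: "nontx_access H [q, r]"
  shows "\<exists>vs'. vs = r # vs'"
proof -
  have nA: "node H [q, r]" using A by (simp add: node_def)
  have "responds H q r" using A by (auto simp: nontx_access_def)
  then obtain us0 vs0 where P: "proj (thread q) H = us0 @ q # r # vs0" unfolding responds_iff by blast
  have "before (proj (thread q) H) q r" unfolding P by simp
  then have "before S q r" unfolding proj_S[symmetric] before_proj by simp
  then have rvs: "r \<in> set vs"
    using distinct_S unfolding S by (auto dest: before_in_set)
  then obtain v vs' where vs: "vs = v # vs'" by (cases vs) auto
  have "v = r"
  proof (rule ccontr)
    assume ne: "v \<noteq> r"
    then have "r \<in> set vs'" using rvs vs by simp
    then have "f q \<le> f v" "f v \<le> f r" using sorted_S unfolding S vs by (auto simp: sorted_append)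
    moreover have "f q = f r" using node_const[OF nA, of q r] by simp
    ultimately have eq: "f v = f q" by simp
    have "v \<in> set H" using S vs set_S by auto
    then obtain \<nu> where "node H \<nu>" "v \<in> set \<nu>" using node_exists[OF history] by blast
    then have "\<nu> = [q, r]" using node_inj[OF _ nA, of \<nu> v q] eq by simp
    with \<open>v \<in> set \<nu>\<close> ne have "v = q" by simp
    then show False using distinct_S unfolding S vs by simp
  qed
  with vs show ?thesis by blast
qed

text \<open>The one clause of \<open>history\<close> that sees how threads interleave. Sorting
  changes the prefix before a request, but not the part of it in the thread of the request, so the
  prefix condition carries over to \<open>H\<close>.\<close>

lemma nontx_request_followed:
  assumes i: "i < length S" and q: "is_access_request (kind (S ! i))"
    and comp: "\<forall>T. thread_transaction (take i S) (thread (S ! i)) T \<longrightarrow> committed_tx T \<or> aborted_tx T"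
  shows "Suc i < length S \<and> thread (S ! Suc i) = thread (S ! i) \<and>
    matches (kind (S ! i)) (kind (S ! Suc i)) \<and> kind (S ! Suc i) \<noteq> Aborted"
proof -
  define q' where "q' = S ! i"
  let ?t = "thread q'"
  define us vs where "us = take i S" and "vs = drop (Suc i) S"
  have S: "S = us @ q' # vs" unfolding us_def vs_def q'_def by (rule id_take_nth_drop[OF i])
  have len: "length us = i" using i by (simp add: us_def)
  have "q' \<in> set H" using S set_S by auto
  then obtain us0 vs0 where H: "H = us0 @ q' # vs0" by (meson split_list)
  have "proj ?t us @ q' # proj ?t vs = proj ?t us0 @ q' # proj ?t vs0"
    using proj_S[of ?t] S H by (simp add: proj_def)
  moreover have "distinct (proj ?t us @ q' # proj ?t vs)"
    using distinct_S unfolding S by (auto simp: proj_def)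
  ultimately have "proj ?t us = proj ?t us0" by (rule distinct_middle_unique[THEN conjunct1])
  then have tt: "thread_transaction us ?t = thread_transaction us0 ?t"
    unfolding thread_transaction_def by simp
  have k: "kind q' \<noteq> BeginTx" using access_request[OF q] by (simp add: q'_def)
  have "\<forall>T. thread_transaction us0 ?t T \<longrightarrow> final (kind (last T))"
    using comp[folded q'_def us_def] unfolding tt final_def committed_tx_def aborted_tx_def .
  then have "nontx H q'" using nontx_iff[OF history H k] by blast
  then obtain r where r: "thread r = ?t" "matches (kind q') (kind r)" "kind r \<noteq> Aborted" "nontx_access H [q', r]"
    using nontx_request_response[OF history H] q unfolding q'_def by metis
  obtain vs' where "vs = r # vs'" using nontx_pair_adjacent[OF S r(4)] by blast
  with S len have "Suc i < length S" "S ! Suc i = r" by (auto simp: nth_append)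
  with r show ?thesis unfolding q'_def by simp
qed

lemma history_S: "history N S"
  unfolding history_def
proof (intro conjI)
  show "\<forall>a \<in> set S. thread a \<in> {1..N}" using history_threads[OF history] by (simp add: set_S)
  show "distinct (map ident S)" using history_idents[OF history] distinct_S by (simp add: distinct_map set_S)
  show "\<forall>t. let P = proj t S in \<forall>i < length P.
        (if even i then is_request (kind (P ! i))
         else matches (kind (P ! (i - 1))) (kind (P ! i)))" unfolding proj_S by (rule history_requests[OF history])
  show "\<forall>t. let B = filter (\<lambda>k. k = BeginTx \<or> k = Committed \<or> k = Aborted) (map kind (proj t S))
        in \<forall>i < length B. even i \<longleftrightarrow> B ! i = BeginTx" unfolding proj_S by (rule history_markers[OF history])
  show "\<forall>a \<in> set S. kind a = TryCommit \<longrightarrow> (\<exists>T. transaction S T \<and> a \<in> set T)"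
    using history_trycommit[OF history] transaction_cong[of S H] proj_S by (simp add: set_S)
  show "\<forall>i < length S. is_access_request (kind (S ! i)) \<and>
        (\<forall>T. thread_transaction (take i S) (thread (S ! i)) T \<longrightarrow> committed_tx T \<or> aborted_tx T) \<longrightarrow>
        Suc i < length S \<and> thread (S ! Suc i) = thread (S ! i) \<and>
        matches (kind (S ! i)) (kind (S ! Suc i)) \<and> kind (S ! Suc i) \<noteq> Aborted"
    using nontx_request_followed by blast
qed

lemma non_interleaved_S: "non_interleaved S"
  unfolding non_interleaved_def
proof (intro allI impI)
  fix T \<nu> assume "transaction S T \<and> (transaction S \<nu> \<or> nontx_access S \<nu>) \<and> \<nu> \<noteq> T"
  then have n: "node H T" "node H \<nu>" "\<nu> \<noteq> T" unfolding node_S[symmetric] by (auto simp: node_def)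
  obtain a0 b0 where ab: "a0 \<in> set T" "b0 \<in> set \<nu>"
    using node_nonempty[OF n(1)] node_nonempty[OF n(2)] last_in_set by blast
  have fa: "f a = f a0" "a \<in> set H" if "a \<in> set T" for a
    using node_const[OF n(1) that ab(1)] node_thread(2)[OF n(1) that that] by auto
  have fb: "f b = f b0" "b \<in> set H" if "b \<in> set \<nu>" for b
    using node_const[OF n(2) that ab(2)] node_thread(2)[OF n(2) that that] by auto
  have "f a0 \<noteq> f b0" using node_inj[OF n(1,2) ab] n(3) by blast
  then consider "f a0 < f b0" | "f b0 < f a0" by linarith
  then show "(\<forall>a \<in> set T. \<forall>b \<in> set \<nu>. before S a b) \<or> (\<forall>a \<in> set T. \<forall>b \<in> set \<nu>. before S b a)"
    by cases (use fa fb before_S_less in auto)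
qed

end

section \<open>Completing commit-pending transactions\<close>

lemma filter_eq_distinct:
  "distinct ts \<Longrightarrow> filter (\<lambda>s. s = t) ts = (if t \<in> set ts then [t] else [])"
  by (induction ts) auto

text \<open>One identifier \<open>g t\<close> per thread suffices, as a thread has at most one
  commit-pending transaction. \<open>V\<close> holds the nodes to be treated as visible; a pending
  transaction is committed or aborted accordingly.\<close>

locale tx_completion =
  fixes N :: nat and H :: "('i, 'x) history" and g :: "nat \<Rightarrow> 'i" and V :: "('i, 'x) node set"
  assumes history: "history N H"
    and inj_g: "inj g"
    and fresh_g: "g t \<notin> ident ` set H"
begin

text \<open>By alternation of requests and responses an unanswered \<open>TryCommit\<close> can only
  be the last action of its thread, so it suffices to look there.\<close>

definition pending :: "nat \<Rightarrow> bool" where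
  "pending t \<longleftrightarrow> proj t H \<noteq> [] \<and> kind (last (proj t H)) = TryCommit"

definition comp_action :: "nat \<Rightarrow> ('i, 'x) action" where
  "comp_action t = (g t, t, if \<exists>\<nu> \<in> V. last (proj t H) \<in> set \<nu> then Committed else Aborted)"

definition Hx :: "('i, 'x) history" where
  "Hx = H @ map comp_action (filter pending [1..<Suc N])"

text \<open>The map from nodes of \<open>H\<close> to nodes of \<open>Hx\<close>. It fixes
  non-transactional accesses, whose last action is a response.\<close>

definition completed :: "('i, 'x) node \<Rightarrow> ('i, 'x) node" where
  "completed \<nu> = \<nu> @ (if kind (last \<nu>) = TryCommit then [comp_action (thread (last \<nu>))] else [])"

lemma ident_comp [simp]: "ident (comp_action t) = g t"
  and thread_comp [simp]: "thread (comp_action t) = t"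
  and final_comp [simp]: "final (kind (comp_action t))"
  by (simp_all add: comp_action_def ident_def thread_def kind_def final_def)

lemma kind_comp: "kind (comp_action t) =
    (if \<exists>\<nu> \<in> V. last (proj t H) \<in> set \<nu> then Committed else Aborted)"
  by (simp add: comp_action_def kind_def)

lemma comp_not_request [simp]: "\<not> is_request (kind (comp_action t))"
  using final_comp final_not_request by blast

lemma comp_notin [simp]: "comp_action t \<notin> set H"
  using fresh_g[of t] ident_comp[of t] by (metis image_eqI)

lemma distinct_P: "distinct (proj t H)"
  using history_distinct_proj[OF history] .

lemma pending_thread: "pending t \<Longrightarrow> t \<in> {1..N}"
proof -
  assume "pending t"
  then have "last (proj t H) \<in> set (proj t H)" by (simp add: pending_def)
  then show ?thesis using history_threads[OF history] by (auto simp: set_proj)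
qed

lemma proj_Hx: "proj t Hx = proj t H @ (if pending t then [comp_action t] else [])"
proof -
  let ?ts = "filter pending [1..<Suc N]"
  have "proj t (map comp_action ?ts) = map comp_action (filter (\<lambda>s. s = t) ?ts)"
    by (simp add: proj_def filter_map comp_def)
  also have "filter (\<lambda>s. s = t) ?ts = (if t \<in> set ?ts then [t] else [])"
    by (rule filter_eq_distinct) simp
  finally show ?thesis using pending_thread[of t] by (auto simp: Hx_def proj_append)
qed

lemma set_Hx: "a \<in> set Hx \<longleftrightarrow> a \<in> set H \<or> (\<exists>t. pending t \<and> a = comp_action t)"
  using pending_thread by (fastforce simp: Hx_def)

lemma pending_transaction:
  assumes "pending t"
  obtains us T where "thread_transaction H t T" "proj t H = us @ T" "last T = last (proj t H)" "tx_block T"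
proof -
  let ?l = "last (proj t H)"
  have "?l \<in> set (proj t H)" using assms by (simp add: pending_def)
  then have l: "?l \<in> set H" "thread ?l = t" by (auto simp: set_proj)
  then obtain T where T: "transaction H T" "?l \<in> set T"
    using history_trycommit[OF history] assms unfolding pending_def by blast
  have tt: "thread_transaction H t T" using transaction_thread[OF T] l(2) by simp
  obtain us vs where P: "proj t H = us @ T @ vs" "tx_block T"
    using history tt by (rule thread_transaction_cases)
  have "vs = []"
  proof (rule ccontr)
    assume "vs \<noteq> []"
    then have "?l \<in> set vs" using P by (metis last_append last_in_set append_is_Nil_conv)
    then show False using T(2) distinct_P[of t] P(1) by auto
  qed
  moreover have "T \<noteq> []" using T(2) by auto
  ultimately show thesis using that[OF tt] P by auto
qed

lemma trycommit_transaction: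
  assumes "thread_transaction H t T" "kind (last T) = TryCommit"
  shows "pending t" "last T = last (proj t H)" "thread (last T) = t"
proof -
  obtain us vs where P: "proj t H = us @ T @ vs" "tx_block T" "vs = [] \<or> final (kind (last T))"
    using history assms(1) by (rule thread_transaction_cases)
  have "vs = []" using P(3) assms(2) by (auto simp: final_def)
  moreover have ne: "T \<noteq> []" using P(2) by (simp add: tx_block_def)
  ultimately show "last T = last (proj t H)" "pending t" using P(1) assms(2) by (auto simp: pending_def)
  show "thread (last T) = t"
    using thread_transaction_set[OF assms(1)] last_in_set[OF ne] by (auto simp: set_proj)
qed

text \<open>The block of a pending transaction contains a begin but no final action, so the last
  marker of the projection is a begin and the added marker falls on an odd position.\<close>

lemma alternating_Hx: "alternating (proj t Hx)"
proof (cases "pending t")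
  case False
  then show ?thesis using history_alternating[OF history, of t] by (simp add: proj_Hx)
next
  case True
  let ?B = "\<lambda>P. filter (\<lambda>k. k = BeginTx \<or> k = Committed \<or> k = Aborted) (map kind P)"
  obtain us T where T: "proj t H = us @ T" "last T = last (proj t H)" "tx_block T"
    using pending_transaction[OF True] by metis
  define Bu BT where B: "Bu = ?B us" "BT = ?B T"
  have nf: "\<forall>a \<in> set T. \<not> final (kind a)"
  proof -
    have "T = butlast T @ [last T]" using T(3) by (simp add: tx_block_def)
    then have "set T = insert (last T) (set (butlast T))"
      by (metis Un_insert_right append_Nil2 empty_set list.simps(15) set_append sup_bot.right_neutral)
    moreover have "\<not> final (kind (last T))" using True T(2) by (simp add: pending_def final_def)
    ultimately show ?thesis using T(3) by (auto simp: tx_block_alt)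
  qed
  have BT: "\<forall>k \<in> set BT. k = BeginTx" using nf by (auto simp: B final_def)
  have "hd T \<in> set T" "kind (hd T) = BeginTx" using T(3) by (auto simp: tx_block_def)
  then have "BeginTx \<in> set BT" by (force simp: B)
  then obtain BT' k where BT': "BT = BT' @ [k]" by (cases BT rule: rev_cases) auto
  then have k: "k = BeginTx" using BT by simp
  let ?c = "kind (comp_action t)"
  have c: "?c \<noteq> BeginTx" using final_comp[of t] by (auto simp: final_def)
  have eqH: "?B (proj t H) = (Bu @ BT') @ [BeginTx]" using T(1) BT' k by (simp add: B)
  have eq: "?B (proj t Hx) = ((Bu @ BT') @ [BeginTx]) @ [?c]"
    using eqH final_comp[of t] True by (auto simp: proj_Hx final_def)
  have *: "even i \<longleftrightarrow> ((Bu @ BT') @ [BeginTx]) ! i = BeginTx" if "i < length ((Bu @ BT') @ [BeginTx])" for i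
    using history_alternating[OF history, of t] that unfolding alternating_def Let_def eqH by blast
  define D where "D = Bu @ BT'"
  have ev: "even (length D)" using *[folded D_def, of "length D"] by simp
  have "even i \<longleftrightarrow> ((D @ [BeginTx]) @ [?c]) ! i = BeginTx" if i: "i < length ((D @ [BeginTx]) @ [?c])" for i
  proof (cases "i < length (D @ [BeginTx])")
    case True
    then show ?thesis using *[folded D_def, of i] by (simp only: nth_append if_True)
  next
    case False
    with i have "i = Suc (length D)" by simp
    with ev c show ?thesis by (simp add: nth_append)
  qed
  then show ?thesis unfolding alternating_def Let_def eq D_def by blast
qed

lemma distinct_Hx: "distinct (proj t Hx)"
  using distinct_P by (auto simp: proj_Hx set_proj)

lemma thread_transaction_complete:
  assumes "thread_transaction H t T"
  shows "thread_transaction Hx t (completed T)"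
proof -
  obtain us vs where P: "proj t H = us @ T @ vs" "tx_block T" "vs = [] \<or> final (kind (last T))"
    using history assms(1) by (rule thread_transaction_cases)
  show ?thesis
  proof (cases "kind (last T) = TryCommit")
    case True
    note tc = trycommit_transaction[OF assms True]
    have "vs = []" using P(3) True by (auto simp: final_def)
    then have "proj t Hx = us @ (T @ [comp_action t]) @ []" using P(1) tc(1) by (simp add: proj_Hx)
    moreover have "tx_block (T @ [comp_action t])"
      using P(2) True by (intro tx_block_snoc) (auto simp: final_def)
    ultimately show ?thesis
      unfolding thread_transaction_iff[OF distinct_Hx alternating_Hx] completed_def using True tc(3)
      by (intro conjI exI[of _ us] exI[of _ "[]"]) simp_all
  next
    case False
    \<comment> \<open>A pending thread ends in \<open>TryCommit\<close> and \<open>T\<close> does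
      not, so \<open>T\<close> is followed by something and hence already closed.\<close>
    have "vs \<noteq> []" if "pending t" using that False P(1,2) by (auto simp: pending_def tx_block_def)
    then have "vs @ (if pending t then [comp_action t] else []) = [] \<or> final (kind (last T))"
      using P(3) by auto
    then show ?thesis
      unfolding thread_transaction_iff[OF distinct_Hx alternating_Hx] completed_def using P(1,2) False
      by (intro conjI exI[of _ us] exI[of _ "vs @ (if pending t then [comp_action t] else [])"])
        (simp_all add: proj_Hx)
  qed
qed

lemma transaction_complete: "transaction H T \<Longrightarrow> transaction Hx (completed T)"
  unfolding transaction_def using thread_transaction_complete by blast

lemma history_Hx: "history N Hx"
  unfolding history_def
proof (intro conjI)
  show "\<forall>a \<in> set Hx. thread a \<in> {1..N}"
  proof
    fix a assume "a \<in> set Hx"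
    then consider "a \<in> set H" | t where "pending t" "a = comp_action t" unfolding set_Hx by blast
    then show "thread a \<in> {1..N}"
      using history_threads[OF history] pending_thread by cases (blast, simp)
  qed
  show "distinct (map ident Hx)"
  proof -
    let ?ts = "filter pending [1..<Suc N]"
    have "map ident Hx = map ident H @ map g ?ts" by (simp add: Hx_def comp_def)
    moreover have "distinct (map g ?ts)"
      using inj_g by (simp add: distinct_map inj_on_subset[OF inj_g])
    moreover have "set (map ident H) \<inter> set (map g ?ts) = {}"
    proof -
      have "ident a \<noteq> g t" if "a \<in> set H" for a t using that fresh_g[of t] by (metis image_eqI)
      then show ?thesis by (auto simp del: split_paired_All)
    qed
    ultimately show ?thesis using history_idents[OF history] by simp
  qed
  show "\<forall>t. let P = proj t Hx in \<forall>i < length P.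
    (if even i then is_request (kind (P ! i)) else matches (kind (P ! (i - 1))) (kind (P ! i)))"
    unfolding Let_def
  proof (intro allI impI)
    fix t i assume i: "i < length (proj t Hx)"
    let ?P = "proj t H"
    show "if even i then is_request (kind (proj t Hx ! i))
      else matches (kind (proj t Hx ! (i - 1))) (kind (proj t Hx ! i))"
    proof (cases "i < length ?P")
      case True
      then have "proj t Hx ! i = ?P ! i" "proj t Hx ! (i - 1) = ?P ! (i - 1)"
        by (auto simp: proj_Hx nth_append)
      with history_request[OF history True] show ?thesis by (simp only:)
    next
      case False
      then have p: "pending t" and il: "i = length ?P" using i by (auto simp: proj_Hx split: if_splits)
      then have c: "proj t Hx ! i = comp_action t" by (simp add: proj_Hx)
      have ne: "?P \<noteq> []" and l: "kind (last ?P) = TryCommit" using p by (auto simp: pending_def)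
      have l1: "i - 1 < length ?P" using ne il by simp
      have "?P ! (i - 1) = last ?P" using ne il by (simp add: last_conv_nth)
      then have k: "kind (?P ! (i - 1)) = TryCommit" "proj t Hx ! (i - 1) = ?P ! (i - 1)"
        using l l1 by (auto simp: proj_Hx nth_append)
      have "\<not> matches k TryCommit" for k :: "'x kind" using matches_request[of k TryCommit] by auto
      \<comment> \<open>\<open>TryCommit\<close> is never a response, which fixes its parity and
        leaves an odd position for the added action.\<close>
      then have "even (i - 1)" using history_request[OF history l1] k(1) by (auto split: if_splits)
      then have "odd i" using ne il by (cases i) auto
      then show ?thesis using k c kind_comp[of t] by simp
    qed
  qed
  show "\<forall>t. let B = filter (\<lambda>k. k = BeginTx \<or> k = Committed \<or> k = Aborted) (map kind (proj t Hx))
    in \<forall>i < length B. even i \<longleftrightarrow> B ! i = BeginTx"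
    using alternating_Hx unfolding alternating_def by blast
  show "\<forall>a \<in> set Hx. kind a = TryCommit \<longrightarrow> (\<exists>T. transaction Hx T \<and> a \<in> set T)"
  proof (intro ballI impI)
    fix a assume a: "a \<in> set Hx" "kind a = TryCommit"
    then have "a \<in> set H" using comp_not_request unfolding set_Hx by (metis is_request.simps(2))
    then obtain T where T: "transaction H T" "a \<in> set T"
      using history_trycommit[OF history] a(2) by blast
    have "a \<in> set (completed T)" using T(2) by (simp add: completed_def)
    with transaction_complete[OF T(1)] show "\<exists>T. transaction Hx T \<and> a \<in> set T" by blast
  qed
  show "\<forall>i < length Hx. is_access_request (kind (Hx ! i)) \<and>
      (\<forall>T. thread_transaction (take i Hx) (thread (Hx ! i)) T \<longrightarrow> committed_tx T \<or> aborted_tx T) \<longrightarrow>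
      Suc i < length Hx \<and> thread (Hx ! Suc i) = thread (Hx ! i) \<and>
      matches (kind (Hx ! i)) (kind (Hx ! Suc i)) \<and> kind (Hx ! Suc i) \<noteq> Aborted"
  proof (intro allI impI)
    fix i assume i: "i < length Hx" and a: "is_access_request (kind (Hx ! i)) \<and>
      (\<forall>T. thread_transaction (take i Hx) (thread (Hx ! i)) T \<longrightarrow> committed_tx T \<or> aborted_tx T)"
    have iH: "i < length H"
    proof (rule ccontr)
      assume "\<not> i < length H"
      moreover define cs where "cs = map comp_action (filter pending [1..<Suc N])"
      ultimately have "Hx ! i \<in> set cs"
        using i unfolding Hx_def cs_def[symmetric] by (simp add: nth_append)
      then have "\<not> is_request (kind (Hx ! i))" using comp_not_request unfolding cs_def by fastforce
      then show False using a access_request by blast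
    qed
    have eq: "Hx ! i = H ! i" "take i Hx = take i H" using iH by (simp_all add: Hx_def nth_append)
    have "Suc i < length H \<and> thread (H ! Suc i) = thread (H ! i) \<and>
      matches (kind (H ! i)) (kind (H ! Suc i)) \<and> kind (H ! Suc i) \<noteq> Aborted"
      using history_nontx[OF history, rule_format, OF iH a[unfolded eq]] .
    then show "Suc i < length Hx \<and> thread (Hx ! Suc i) = thread (Hx ! i) \<and>
      matches (kind (Hx ! i)) (kind (Hx ! Suc i)) \<and> kind (Hx ! Suc i) \<noteq> Aborted"
      unfolding eq by (simp add: Hx_def nth_append)
  qed
qed

text \<open>The begin of a transaction of \<open>Hx\<close> is not an added action, so it lies in
  some transaction of \<open>H\<close>. The completion of that one shares this begin, and
  transactions sharing an action coincide.\<close>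

lemma transaction_Hx: "transaction Hx T' \<longleftrightarrow> (\<exists>T. transaction H T \<and> T' = completed T)"
proof
  assume T': "transaction Hx T'"
  then obtain t where t: "thread_transaction Hx t T'" unfolding transaction_def by blast
  have ne: "T' \<noteq> []" and b: "kind (hd T') = BeginTx"
    using t by (auto simp: thread_transaction_def tx_block_def)
  have "hd T' \<in> set (proj t Hx)" using ne thread_transaction_set[OF t] by auto
  moreover have "hd T' \<noteq> comp_action t" using b final_comp[of t] by (auto simp: final_def)
  ultimately have "hd T' \<in> set (proj t H)" by (auto simp: proj_Hx split: if_splits)
  then obtain us vs where "proj t H = us @ [hd T'] @ vs" by (metis append_Cons append_Nil split_list)
  moreover have "tx_block [hd T']" using b by (simp add: tx_block_def)
  ultimately obtain T where T: "thread_transaction H t T" "set [hd T'] \<subseteq> set T"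
    by (rule block_in_transaction[OF history])
  then have tr: "transaction H T" unfolding transaction_def by blast
  have "hd T' \<in> set (completed T)" using T(2) by (simp add: completed_def)
  then have "T' = completed T"
    using transaction_unique[OF history_Hx T' transaction_complete[OF tr], of "hd T'"] ne by simp
  with tr show "\<exists>T. transaction H T \<and> T' = completed T" by blast
next
  assume "\<exists>T. transaction H T \<and> T' = completed T"
  then show "transaction Hx T'" using transaction_complete by blast
qed

lemma set_completed: "a \<in> set H \<Longrightarrow> a \<in> set (completed \<nu>) \<longleftrightarrow> a \<in> set \<nu>"
  by (auto simp: completed_def)

lemma nontx_Hx:
  assumes "a \<in> set H"
  shows "nontx Hx a \<longleftrightarrow> nontx H a"
  using assms set_completed[OF assms] unfolding nontx_def transaction_Hx set_Hx by blast

text \<open>Restricted to \<open>r\<close> in \<open>H\<close>, since \<open>Hx\<close> has in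
  addition the new response to each pending \<open>TryCommit\<close>.\<close>

lemma responds_Hx:
  assumes "r \<in> set H"
  shows "responds Hx q r \<longleftrightarrow> responds H q r"
proof
  assume "responds Hx q r"
  then obtain us vs where m: "matches (kind q) (kind r)" and P: "proj (thread q) Hx = us @ q # r # vs"
    unfolding responds_iff by blast
  have "\<exists>vs'. proj (thread q) H = us @ q # r # vs'"
  proof (cases "pending (thread q)")
    case True
    then have e: "proj (thread q) H @ [comp_action (thread q)] = us @ q # r # vs" using P by (simp add: proj_Hx)
    have "vs \<noteq> []"
    proof
      assume "vs = []"
      then have "proj (thread q) H @ [comp_action (thread q)] = (us @ [q]) @ [r]" using e by simp
      then have "r = comp_action (thread q)" by (metis last_snoc)
      with assms show False by simp
    qed
    then obtain vs' v where "vs = vs' @ [v]" by (cases vs rule: rev_cases) auto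
    with e have "proj (thread q) H @ [comp_action (thread q)] = (us @ q # r # vs') @ [v]" by simp
    then have "proj (thread q) H = us @ q # r # vs'" by (metis butlast_snoc)
    then show ?thesis by blast
  qed (use P in \<open>simp add: proj_Hx\<close>)
  with m show "responds H q r" unfolding responds_iff by blast
next
  assume "responds H q r"
  then obtain us vs where "matches (kind q) (kind r)" "proj (thread q) H = us @ q # r # vs"
    unfolding responds_iff by blast
  then show "responds Hx q r" unfolding responds_iff proj_Hx
    by (intro conjI exI[of _ us] exI[of _ "vs @ (if pending (thread q) then [comp_action (thread q)] else [])"])
      simp_all
qed

lemma nontx_access_Hx: "nontx_access Hx A \<longleftrightarrow> nontx_access H A"
proof
  assume "nontx_access Hx A"
  then obtain q r where A: "A = [q, r]" "is_access_request (kind q)" "responds Hx q r" "nontx Hx q" "nontx Hx r"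
    unfolding nontx_access_def by blast
  have "q \<in> set H" using A(2,4) access_request comp_not_request unfolding nontx_def set_Hx by blast
  moreover have "r \<in> set H"
  proof (rule ccontr)
    assume "r \<notin> set H"
    then obtain t where t: "pending t" "r = comp_action t" using A(5) unfolding nontx_def set_Hx by blast
    obtain us T where T: "thread_transaction H t T" "last T = last (proj t H)"
      using pending_transaction[OF t(1)] by metis
    have k: "kind (last T) = TryCommit" using T(2) t(1) by (simp add: pending_def)
    have "r \<in> set (completed T)"
      using k t(2) trycommit_transaction(3)[OF T(1) k] by (simp add: completed_def)
    moreover have "transaction Hx (completed T)" using T(1) transaction_Hx transaction_def by blast
    ultimately show False using A(5) unfolding nontx_def by blast
  qed
  ultimately show "nontx_access H A"
    unfolding nontx_access_def using A nontx_Hx responds_Hx by blast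
next
  assume "nontx_access H A"
  then obtain q r where A: "A = [q, r]" "is_access_request (kind q)" "responds H q r" "nontx H q" "nontx H r"
    unfolding nontx_access_def by blast
  moreover have "q \<in> set H" "r \<in> set H" using A(4,5) by (auto simp: nontx_def)
  ultimately show "nontx_access Hx A"
    unfolding nontx_access_def using nontx_Hx responds_Hx by blast
qed

lemma completed_nontx: "nontx_access H A \<Longrightarrow> completed A = A"
  unfolding nontx_access_def responds_def completed_def using matches_request by force

lemma node_Hx: "node Hx \<nu>' \<longleftrightarrow> (\<exists>\<nu>. node H \<nu> \<and> \<nu>' = completed \<nu>)"
  unfolding node_def transaction_Hx nontx_access_Hx using completed_nontx by metis

lemma completed_pending: 
  assumes "node H \<nu>" "comp_action t \<in> set (completed \<nu>)"
  shows "last (proj t H) \<in> set \<nu>" "transaction H \<nu>"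
proof -
  have "comp_action t \<notin> set \<nu>" using node_thread(2)[OF assms(1)] comp_notin by blast
  then have k: "kind (last \<nu>) = TryCommit" and e: "comp_action t = comp_action (thread (last \<nu>))"
    using assms(2) by (auto simp: completed_def split: if_splits)
  have t: "thread (last \<nu>) = t" using e thread_comp by metis
  have ne: "\<nu> \<noteq> []" by (rule node_nonempty[OF assms(1)])
  show tr: "transaction H \<nu>"
    using assms(1) k matches_request unfolding node_def nontx_access_def responds_def by fastforce
  have "thread_transaction H t \<nu>" using transaction_thread[OF tr, of "last \<nu>"] ne t by simp
  then have "last \<nu> = last (proj t H)" using trycommit_transaction(2) k by blast
  with ne show "last (proj t H) \<in> set \<nu>" using last_in_set by metis
qed

text \<open>
  Ranks of the extended history are read off the original one. An added
  response ends the projection to its thread, so its request is the last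
  action of the original projection.
\<close>

definition core :: "('i, 'x) action \<Rightarrow> ('i, 'x) action" where
  "core a = (if a \<in> set H then a else last (proj (thread a) H))"

text \<open>Lets the two level-set conditions for the composed key be pulled back from
  \<open>Hx\<close> to \<open>H\<close>.\<close>

lemma core_complete:
  assumes "node H \<nu>" "a \<in> set (completed \<nu>)"
  shows "core a \<in> set \<nu>"
proof (cases "a \<in> set H")
  case True
  with assms set_completed show ?thesis by (simp add: core_def)
next
  case False
  then have "a \<notin> set \<nu>" using node_thread(2)[OF assms(1)] by blast
  with assms(2) have "a = comp_action (thread (last \<nu>))" by (auto simp: completed_def split: if_splits)
  with completed_pending(1)[OF assms(1)] assms(2) False show ?thesis by (simp add: core_def)
qed

lemma serialization_Hx:
  assumes "serialization N H f"
  shows "serialization N Hx (f \<circ> core)"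
proof -
  interpret f: serialization N H f by (rule assms)
  show ?thesis
  proof
    show "history N Hx" by (rule history_Hx)
  next
    fix t
    have m: "map (f \<circ> core) (proj t H) = map f (proj t H)"
      by (auto simp: core_def set_proj)
    \<comment> \<open>The last key of a sorted projection is maximal, so an added response with that
      same key keeps it sorted.\<close>
    have "f a \<le> f (last (proj t H))" if "a \<in> set (proj t H)" for a
    proof -
      have "proj t H = butlast (proj t H) @ [last (proj t H)]" using that by (cases "proj t H" rule: rev_cases) auto
      then show ?thesis using f.mono[of t] that
        by (cases "proj t H" rule: rev_cases) (auto simp: sorted_append)
    qed
    then show "sorted (map (f \<circ> core) (proj t Hx))"
      unfolding proj_Hx map_append m using f.mono[of t] by (auto simp: sorted_append core_def)
  next
    fix \<nu> a b assume "node Hx \<nu>" "a \<in> set \<nu>" "b \<in> set \<nu>"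
    then show "(f \<circ> core) a = (f \<circ> core) b"
      unfolding node_Hx using core_complete f.node_const by fastforce
  next
    fix \<nu> \<nu>' a b
    assume *: "node Hx \<nu>" "node Hx \<nu>'" "a \<in> set \<nu>" "b \<in> set \<nu>'" "(f \<circ> core) a = (f \<circ> core) b"
    then show "\<nu> = \<nu>'"
      unfolding node_Hx using core_complete f.node_inj by (metis comp_apply)
  qed
qed

lemma completed_cases:
  assumes "transaction H T"
  shows "kind (last (completed T)) = TryCommit \<longleftrightarrow> False"
    "committed_tx (completed T) \<longleftrightarrow> committed_tx T \<or> commit_pending_tx T \<and> (\<exists>\<nu> \<in> V. last T \<in> set \<nu>)"
proof -
  obtain t where t: "thread_transaction H t T" using assms unfolding transaction_def by blast
  show "kind (last (completed T)) = TryCommit \<longleftrightarrow> False"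
    using final_comp by (auto simp: completed_def final_def kind_comp)
  show "committed_tx (completed T) \<longleftrightarrow> committed_tx T \<or> commit_pending_tx T \<and> (\<exists>\<nu> \<in> V. last T \<in> set \<nu>)"
    using trycommit_transaction[OF t]
    by (auto simp: completed_def committed_tx_def commit_pending_tx_def kind_comp)
qed

end

section \<open>Legality of the serialization\<close>

text \<open>Without repetitions the bijection is forced: it sends a position of \<open>H\<close> to
  the position of the same action in \<open>S\<close>.\<close>

lemma corresponds_if_before:
  assumes "distinct H" "distinct S" "set H = set S"
    and "\<And>a b. po H a b \<or> cl H a b \<Longrightarrow> before S a b"
  shows "H \<sqsubseteq>\<^sub>H S"
proof -
  let ?inv = "inv_into {..<length S} ((!) S)"
  have bS: "bij_betw ((!) S) {..<length S} (set S)" using assms(2) by (intro bij_betw_nth) auto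
  have bH: "bij_betw ((!) H) {..<length H} (set S)" using assms(1,3) by (intro bij_betw_nth) auto
  have b: "bij_betw (?inv \<circ> (!) H) {..<length H} {..<length S}"
    using bH bij_betw_inv_into[OF bS] by (rule bij_betw_trans)
  have eq: "S ! ((?inv \<circ> (!) H) i) = H ! i" if "i < length H" for i
  proof -
    have "H ! i \<in> set S" using assms(3) nth_mem[OF that] by simp
    then have "H ! i \<in> (!) S ` {..<length S}" using bS by (simp add: bij_betw_def)
    then show ?thesis by (simp add: f_inv_into_f)
  qed
  have "(?inv \<circ> (!) H) i < (?inv \<circ> (!) H) j"
    if ij: "i < j" "j < length H" "po H (H ! i) (H ! j) \<or> cl H (H ! i) (H ! j)" for i j
  proof (rule before_nth[OF assms(2)])
    have i: "i < length H" using ij by simp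
    show "before S (S ! ((?inv \<circ> (!) H) i)) (S ! ((?inv \<circ> (!) H) j))"
      unfolding eq[OF i] eq[OF ij(2)] using ij(3) by (rule assms(4))
    show "(?inv \<circ> (!) H) i < length S" "(?inv \<circ> (!) H) j < length S"
      using bij_betw_apply[OF b] i ij(2) by blast+
  qed
  with b eq show ?thesis unfolding corresponds_def by (intro exI[of _ "?inv \<circ> (!) H"]) simp
qed

text \<open>Acyclicity enters only through the rank \<open>rk\<close>, which increases along every
  edge.\<close>

locale acyclic_opacity_graph = tx_completion N H g "vis G"
  for N :: nat and H :: "('i, 'x) history" and g :: "nat \<Rightarrow> 'i" and G :: "('i, 'x) opgraph" +
  fixes vinit :: int and rk :: "('i, 'x) node \<Rightarrow> nat"
  assumes cons: "cons vinit H"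
    and G: "G \<in> Graph vinit H"
    and rk_inj: "inj_on rk {\<nu>. node H \<nu>}"
    and rk_edge: "(\<nu>, \<nu>') \<in> edges G \<Longrightarrow> node H \<nu> \<Longrightarrow> node H \<nu>' \<Longrightarrow> rk \<nu> < rk \<nu>'"
begin

section \<open>From ranked nodes to sorted actions\<close>

lemma graph: "wf_nodes H G" "wf_WR H G" "WR_serves_reads vinit H G" "wf_WW G" "wf_RW vinit H G" "wf_PO_CL H G"
  using G by (simp_all add: Graph_def)

lemma verts: "verts G = {\<nu>. node H \<nu>}"
proof -
  have "verts G = {T. transaction H T} \<union> {A. nontx_access H A}"
    using graph(1) unfolding wf_nodes_def by (elim conjE)
  then show ?thesis unfolding node_def by auto
qed

lemma vis_node: "\<nu> \<in> vis G \<Longrightarrow> node H \<nu>"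
proof -
  have "vis G \<subseteq> verts G" using graph(1) unfolding wf_nodes_def by (elim conjE)
  then show "\<nu> \<in> vis G \<Longrightarrow> node H \<nu>" unfolding verts by auto
qed

lemma rk_less:
  assumes "(\<nu>, \<nu>') \<in> WR G x \<or> (\<nu>, \<nu>') \<in> WW G x \<or> (\<nu>, \<nu>') \<in> RW G x \<or> (\<nu>, \<nu>') \<in> PO G \<or> (\<nu>, \<nu>') \<in> CL G"
    and "node H \<nu>" "node H \<nu>'"
  shows "rk \<nu> < rk \<nu>'"
proof (rule rk_edge)
  show "(\<nu>, \<nu>') \<in> edges G" using assms(1) unfolding edges_def by auto
qed (use assms in simp_all)

lemma PO_iff: "(\<nu>, \<nu>') \<in> PO G \<longleftrightarrow> node H \<nu> \<and> node H \<nu>' \<and> \<nu> \<noteq> \<nu>' \<and>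
    (\<exists>a \<in> set \<nu>. \<exists>a' \<in> set \<nu>'. po H a a')"
  using graph(6) unfolding wf_PO_CL_def verts by simp

lemma CL_iff: "(\<nu>, \<nu>') \<in> CL G \<longleftrightarrow> node H \<nu> \<and> node H \<nu>' \<and> \<nu> \<noteq> \<nu>' \<and>
    (\<exists>a \<in> set \<nu>. \<exists>a' \<in> set \<nu>'. cl H a a')"
  using graph(6) unfolding wf_PO_CL_def verts by simp

lemma RW_iff: "(\<nu>, \<nu>') \<in> RW G x \<longleftrightarrow> node H \<nu> \<and> node H \<nu>' \<and> \<nu> \<noteq> \<nu>' \<and>
    ((\<exists>\<nu>''. (\<nu>'', \<nu>') \<in> WW G x \<and> (\<nu>'', \<nu>) \<in> WR G x) \<or>
      \<nu>' \<in> visible_writers G x \<and> node_reads H x vinit \<nu>)"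
  using graph(5) unfolding wf_RW_def verts by simp

text \<open>Determined on actions of \<open>H\<close> because the nodes partition them. On added
  responses the \<open>THE\<close> has no node to pick, and \<open>core\<close> replaces them
  first.\<close>

definition action_rank :: "('i, 'x) action \<Rightarrow> nat" where
  "action_rank a = rk (THE \<nu>. node H \<nu> \<and> a \<in> set \<nu>)"

lemma action_rank_eq:
  assumes "node H \<nu>" "a \<in> set \<nu>"
  shows "action_rank a = rk \<nu>"
proof -
  have "(THE \<nu>. node H \<nu> \<and> a \<in> set \<nu>) = \<nu>"
  proof (rule the_equality)
    fix \<mu> assume "node H \<mu> \<and> a \<in> set \<mu>"
    then show "\<mu> = \<nu>" using node_unique[OF history _ assms(1) _ assms(2)] by simp
  qed (use assms in simp)
  then show ?thesis by (simp add: action_rank_def)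
qed

lemma action_rank_po:
  assumes "po H a b"
  shows "action_rank a \<le> action_rank b"
proof -
  have "before H a b" using assms by (simp add: po_def)
  then have ab: "a \<in> set H" "b \<in> set H" using before_in_set by blast+
  obtain \<nu> where \<nu>: "node H \<nu>" "a \<in> set \<nu>" using history ab(1) by (rule node_exists)
  obtain \<nu>' where \<nu>': "node H \<nu>'" "b \<in> set \<nu>'" using history ab(2) by (rule node_exists)
  note n = \<nu> \<nu>'
  show ?thesis
  proof (cases "\<nu> = \<nu>'")
    case False
    then have "(\<nu>, \<nu>') \<in> PO G" using n assms unfolding PO_iff by blast
    then have "rk \<nu> < rk \<nu>'" using rk_less n by blast
    then show ?thesis using action_rank_eq[OF n(1,2)] action_rank_eq[OF n(3,4)] by simp
  qed (use action_rank_eq[OF n(1,2)] action_rank_eq[OF n(3,4)] in simp)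
qed

text \<open>Different threads force different nodes, hence a strict inequality and a definite order
  after sorting. Pairs in one thread are left to the preservation of projections.\<close>

lemma action_rank_cl:
  assumes "cl H a b" "thread a \<noteq> thread b"
  shows "action_rank a < action_rank b"
proof -
  have "before H a b" using assms by (simp add: cl_def)
  then have ab: "a \<in> set H" "b \<in> set H" using before_in_set by blast+
  obtain \<nu> where \<nu>: "node H \<nu>" "a \<in> set \<nu>" using history ab(1) by (rule node_exists)
  obtain \<nu>' where \<nu>': "node H \<nu>'" "b \<in> set \<nu>'" using history ab(2) by (rule node_exists)
  note n = \<nu> \<nu>'
  have "\<nu> \<noteq> \<nu>'" using node_thread(1)[OF n(1) n(2)] n(4) assms(2) by blast
  then have "(\<nu>, \<nu>') \<in> CL G" using n assms unfolding CL_iff by blast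
  then have "rk \<nu> < rk \<nu>'" using rk_less n by blast
  then show ?thesis using action_rank_eq[OF n(1,2)] action_rank_eq[OF n(3,4)] by simp
qed

sublocale ser: serialization N H action_rank
proof
  show "history N H" by (rule history)
next
  fix t show "sorted (map action_rank (proj t H))"
  proof (rule sorted_beforeI)
    fix a b assume "before (proj t H) a b"
    then have "po H a b" by (simp add: before_proj po_def)
    then show "action_rank a \<le> action_rank b" by (rule action_rank_po)
  qed
next
  fix \<nu> a b assume n: "node H \<nu>" "a \<in> set \<nu>" "b \<in> set \<nu>"
  show "action_rank a = action_rank b" using action_rank_eq[OF n(1,2)] action_rank_eq[OF n(1,3)] by simp
next
  fix \<nu> \<nu>' a b assume n: "node H \<nu>" "node H \<nu>'" "a \<in> set \<nu>" "b \<in> set \<nu>'" "action_rank a = action_rank b"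
  then have "rk \<nu> = rk \<nu>'" using action_rank_eq[OF n(1,3)] action_rank_eq[OF n(2,4)] by simp
  then show "\<nu> = \<nu>'" using inj_onD[OF rk_inj, of \<nu> \<nu>'] n by simp
qed

sublocale serx: serialization N Hx "action_rank \<circ> core"
  by (rule serialization_Hx) unfold_locales

lemma corresponds_S: "H \<sqsubseteq>\<^sub>H ser.S"
proof (rule corresponds_if_before)
  show "distinct H" by (rule history_distinct[OF history])
  show "distinct ser.S" by (rule ser.distinct_S)
  show "set H = set ser.S" by (simp add: ser.set_S)
  fix a b assume *: "po H a b \<or> cl H a b"
  show "before ser.S a b"
  proof (cases "thread a = thread b")
    case True
    with * show ?thesis using ser.before_S_thread by (auto simp: po_def cl_def)
  next
    case False
    with * have "cl H a b" by (simp add: po_def)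
    with False have "action_rank a < action_rank b" "a \<in> set H" "b \<in> set H"
      using action_rank_cl before_in_set unfolding cl_def by blast+
    then show ?thesis using ser.before_S_less by blast
  qed
qed

section \<open>The sorted completion and its visible writes\<close>

lemma filter_Hx: "filter (\<lambda>a. a \<in> set H) Hx = H"
  by (auto simp: Hx_def filter_empty_conv)

text \<open>Filtering commutes with stable sorting and \<open>core\<close> is the identity on
  \<open>H\<close>, so deleting the added responses from the completion leaves exactly the sorted
  \<open>H\<close>.\<close>

lemma subseq_S: "subseq ser.S serx.S"
proof -
  have "filter (\<lambda>a. a \<in> set H) serx.S = sort_key (action_rank \<circ> core) H"
    unfolding serx.S_def filter_sort filter_Hx ..
  also have "\<dots> = ser.S" unfolding ser.S_def by (rule sort_key_cong) (simp add: core_def)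
  finally show ?thesis by (metis subseq_filter_left)
qed

lemma transaction_Hc: "transaction serx.S T' \<longleftrightarrow> (\<exists>T. transaction H T \<and> T' = completed T)"
  using transaction_cong[of serx.S Hx] serx.proj_S transaction_Hx by simp

lemma completion_S: "completion N ser.S serx.S"
  unfolding completion_def
proof (intro conjI)
  show "\<forall>T. transaction serx.S T \<longrightarrow> \<not> commit_pending_tx T"
    unfolding transaction_Hc commit_pending_tx_def using completed_cases(1) by blast
  have "final (kind a)" if "a \<in> set Hx" "a \<notin> set H" for a
    using that final_comp unfolding set_Hx by blast
  then show "\<forall>a \<in> set serx.S - set ser.S. kind a = Committed \<or> kind a = Aborted"
    unfolding serx.set_S ser.set_S final_def by blast
qed (rule serx.history_S serx.non_interleaved_S subseq_S)+

text \<open>Completion turns visibility into commitment. No completed transaction is commit-pending,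
  so aborted or live means not committed, and the choice in \<open>comp_action\<close> makes a
  pending transaction committed precisely if it is in \<open>vis G\<close>.\<close>

lemma completed_vis:
  assumes T: "transaction H T"
  shows "aborted_tx (completed T) \<or> live_tx (completed T) \<longleftrightarrow> T \<notin> vis G"
proof -
  have nT: "node H T" using T by (simp add: node_def)
  have l: "last T \<in> set T" using node_nonempty[OF nT] by simp
  have "(\<exists>\<nu> \<in> vis G. last T \<in> set \<nu>) \<longleftrightarrow> T \<in> vis G"
    using node_unique[OF history nT] vis_node l by blast
  then have "committed_tx (completed T) \<longleftrightarrow> committed_tx T \<or> commit_pending_tx T \<and> T \<in> vis G"
    using completed_cases(2)[OF T] by simp
  moreover have "\<not> commit_pending_tx (completed T)"
    using completed_cases(1)[OF T] by (simp add: commit_pending_tx_def)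
  moreover have "committed_tx T \<longrightarrow> T \<in> vis G" "aborted_tx T \<or> live_tx T \<longrightarrow> T \<notin> vis G"
    using graph(1) T unfolding wf_nodes_def by simp_all
  moreover have "\<not> (committed_tx U \<and> aborted_tx U)" for U :: "('i, 'x) node"
    by (simp add: committed_tx_def aborted_tx_def)
  ultimately show ?thesis unfolding live_tx_def by blast
qed

lemma nontx_vis: "nontx_access H A \<Longrightarrow> A \<in> vis G"
  using graph(1) unfolding wf_nodes_def by simp

text \<open>Translates the status test of \<open>legal\<close> into graph terms. A non-transactional
  access is always visible, so the test can be put uniformly for all nodes.\<close>

lemma eligible_iff:
  assumes w: "w \<in> set \<mu>" "node H \<mu>" and r: "r \<in> set \<nu>" "node H \<nu>"
  shows "eligible_write serx.S r x w \<longleftrightarrow> writes_to x w \<and> before serx.S w r \<and> (\<mu> = \<nu> \<or> \<mu> \<in> vis G)"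
proof -
  have wH: "w \<in> set H" "r \<in> set H" using node_thread(2) w r by blast+
  have "(\<exists>T. transaction serx.S T \<and> (aborted_tx T \<or> live_tx T) \<and> w \<in> set T \<and> r \<notin> set T) \<longleftrightarrow>
    (\<exists>T. transaction H T \<and> T \<notin> vis G \<and> w \<in> set T \<and> r \<notin> set T)"
    unfolding transaction_Hc using completed_vis set_completed wH by blast
  also have "\<dots> \<longleftrightarrow> transaction H \<mu> \<and> \<mu> \<notin> vis G \<and> r \<notin> set \<mu>"
    using w node_unique[OF history] unfolding node_def by blast
  also have "\<dots> \<longleftrightarrow> \<mu> \<notin> vis G \<and> \<mu> \<noteq> \<nu>"
    using w r node_unique[OF history] nontx_vis unfolding node_def by blast
  finally show ?thesis unfolding eligible_write_def by blast
qed

lemma eligible_node: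
  assumes "eligible_write serx.S r x w"
  obtains \<mu> where "w \<in> set \<mu>" "node H \<mu>"
proof -
  have "w \<in> set Hx" using assms before_in_set unfolding eligible_write_def serx.set_S[symmetric] by blast
  moreover have "is_request (kind w)" using assms unfolding eligible_write_def writes_to_def by auto
  ultimately have "w \<in> set H" using comp_not_request unfolding set_Hx by blast
  then show thesis using node_exists[OF history] that by metis
qed

lemma action_rank_core: "node H \<nu> \<Longrightarrow> a \<in> set \<nu> \<Longrightarrow> (action_rank \<circ> core) a = rk \<nu>"
  using action_rank_eq[of \<nu> a] node_thread(2)[of H \<nu> a a] by (simp add: core_def)

lemma before_Hc_less:
  assumes "node H \<mu>" "node H \<nu>" "a \<in> set \<mu>" "b \<in> set \<nu>" "rk \<mu> < rk \<nu>"
  shows "before serx.S a b"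
proof (rule serx.before_S_less)
  show "a \<in> set Hx" "b \<in> set Hx" using assms node_thread(2) unfolding set_Hx by blast+
  show "(action_rank \<circ> core) a < (action_rank \<circ> core) b"
    unfolding action_rank_core[OF assms(1,3)] action_rank_core[OF assms(2,4)] by (rule assms(5))
qed

lemma before_Hc_le:
  assumes "node H \<mu>" "node H \<nu>" "a \<in> set \<mu>" "b \<in> set \<nu>" "before serx.S a b" "\<mu> \<noteq> \<nu>"
  shows "rk \<mu> < rk \<nu>"
proof -
  have "rk \<mu> \<le> rk \<nu>"
    using serx.before_S_le[OF assms(5)] unfolding action_rank_core[OF assms(1,3)] action_rank_core[OF assms(2,4)] .
  moreover have "rk \<mu> \<noteq> rk \<nu>" using inj_onD[OF rk_inj, of \<mu> \<nu>] assms by auto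
  ultimately show ?thesis by simp
qed

lemma before_Hc_thread:
  assumes "a \<in> set H" "b \<in> set H" "thread a = thread b"
  shows "before serx.S a b \<longleftrightarrow> before H a b"
proof -
  have "before serx.S a b \<longleftrightarrow> before Hx a b" by (rule serx.before_S_thread[OF assms(3)])
  also have "\<dots> \<longleftrightarrow> before H a b"
  proof -
    define cs where "cs = map comp_action (filter pending [1..<Suc N])"
    have "b \<notin> set cs" using assms(2) comp_notin unfolding cs_def by auto
    then show ?thesis unfolding Hx_def cs_def[symmetric] by (auto dest: before_in_set)
  qed
  finally show ?thesis .
qed

section \<open>Legality of the reads\<close>

lemma visible_writer: "node H \<mu> \<Longrightarrow> \<mu> \<in> vis G \<Longrightarrow> w \<in> set \<mu> \<Longrightarrow> writes_to x w \<Longrightarrow> \<mu> \<in> visible_writers G x"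
  unfolding visible_writers_def verts node_writes_def writes_to_def by blast

lemma WW_total:
  assumes "\<mu> \<in> visible_writers G x" "\<nu> \<in> visible_writers G x" "\<mu> \<noteq> \<nu>"
  shows "(\<mu>, \<nu>) \<in> WW G x \<or> (\<nu>, \<mu>) \<in> WW G x"
proof -
  have "strict_linear_order_on (visible_writers G x) (WW G x)"
    using graph(4) unfolding wf_WW_def by simp
  then show ?thesis using assms unfolding strict_linear_order_on_def total_on_def by blast
qed

text \<open>The witness is the write that consistency provides. Competing writes of the same
  transaction keep their order from \<open>H\<close>; those of other nodes precede the read, so
  their nodes are ranked below the whole transaction and they precede the witness as well.\<close>

lemma legal_local_read:
  assumes rd: "reads H q r x v" and loc: "local_read H q x T"
  shows "\<exists>w. eligible_write serx.S r x w \<and> kind w = WriteReq x v \<and>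
    (\<forall>w'. eligible_write serx.S r x w' \<and> w' \<noteq> w \<longrightarrow> before serx.S w' w)"
proof -
  have rsp: "responds H q r" and kq: "kind q = ReadReq x" using rd by (auto simp: reads_def)
  have T: "node H T" "q \<in> set T" using loc by (auto simp: local_read_def node_def)
  have rT: "r \<in> set T" using node_response[OF history T rsp] .
  obtain w where w: "w \<in> set T" "kind w = WriteReq x v" "before H w q"
    and last: "\<And>w'. w' \<in> set T \<Longrightarrow> writes_to x w' \<Longrightarrow> before H w' q \<Longrightarrow> w' \<noteq> w \<Longrightarrow> before H w' w"
    using cons rd loc unfolding cons_def by blast
  have br: "before serx.S w' r \<longleftrightarrow> before H w' q" if "w' \<in> set T" "writes_to x w'" for w'
  proof -
    have "thread w' = thread r" "thread w' = thread q" "w' \<in> set H" "r \<in> set H"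
      using node_thread[OF T(1)] that(1) T(2) rT by blast+
    moreover have "w' \<noteq> q" using that(2) kq by (auto simp: writes_to_def)
    ultimately show ?thesis using before_Hc_thread before_response_iff[OF history rsp] by simp
  qed
  have wx: "writes_to x w" using w(2) by (auto simp: writes_to_def)
  have "eligible_write serx.S r x w"
    unfolding eligible_iff[OF w(1) T(1) rT T(1)] using wx br[OF w(1) wx] w(3) by blast
  moreover have "before serx.S w' w" if el: "eligible_write serx.S r x w'" and ne: "w' \<noteq> w" for w'
  proof -
    obtain \<mu> where \<mu>: "w' \<in> set \<mu>" "node H \<mu>" using eligible_node[OF el] .
    have w': "writes_to x w'" "before serx.S w' r" using el unfolding eligible_write_def by blast+
    show ?thesis
    proof (cases "\<mu> = T")
      case True
      then have "before H w' w" using last[of w'] br[of w'] w' \<mu> ne by blast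
      then show ?thesis
        using before_Hc_thread node_thread[OF T(1)] \<mu>(1) True w(1) by blast
    next
      case False
      then show ?thesis using before_Hc_less before_Hc_le \<mu> T(1) rT w(1) w'(2) by blast
    qed
  qed
  ultimately show ?thesis using w(2) by blast
qed

text \<open>An eligible write in the reader's own node is impossible: in a transaction it would make
  the read local, and an access contains a single request. Hence eligible writes come from visible
  nodes of strictly smaller rank.\<close>

lemma nonlocal_eligible:
  assumes rd: "nonlocal_read H q r x v" and \<nu>: "node H \<nu>" "q \<in> set \<nu>" and r: "r \<in> set \<nu>"
    and el: "eligible_write serx.S r x w" and \<mu>: "w \<in> set \<mu>" "node H \<mu>"
  shows "\<mu> \<noteq> \<nu> \<and> \<mu> \<in> visible_writers G x \<and> rk \<mu> < rk \<nu>"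
proof -
  have rsp: "responds H q r" and kq: "kind q = ReadReq x"
    using rd by (auto simp: nonlocal_read_def reads_def)
  have w: "writes_to x w" "before serx.S w r" "\<mu> = \<nu> \<or> \<mu> \<in> vis G"
    using el unfolding eligible_iff[OF \<mu> r \<nu>(1)] by blast+
  have wq: "w \<noteq> q" using w(1) kq by (auto simp: writes_to_def)
  have ne: "\<mu> \<noteq> \<nu>"
  proof
    assume eq: "\<mu> = \<nu>"
    show False
    proof (cases "transaction H \<nu>")
      case True
      have "thread w = thread r" "thread w = thread q" "w \<in> set H" "r \<in> set H"
        using node_thread[OF \<nu>(1)] \<mu>(1) eq \<nu>(2) r by blast+
      then have "before H w q"
        using w(2) wq before_Hc_thread before_response_iff[OF history rsp] by simp
      then have "local_read H q x \<nu>"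
        using True \<nu>(2) \<mu>(1) eq w(1) unfolding local_read_def by blast
      then show False using rd unfolding nonlocal_read_def by blast
    next
      case False
      then obtain a b where ab: "\<nu> = [a, b]" "matches (kind a) (kind b)"
        using \<nu>(1) unfolding node_def nontx_access_def responds_def by blast
      have "is_request (kind w)" "is_request (kind q)" using w(1) kq by (auto simp: writes_to_def)
      then show False using ab matches_request[OF ab(2)] \<nu>(2) \<mu>(1) eq wq by auto
    qed
  qed
  then have "\<mu> \<in> visible_writers G x" using visible_writer \<mu> w by blast
  moreover have "rk \<mu> < rk \<nu>" using before_Hc_le[OF \<mu>(2) \<nu>(1) \<mu>(1) r w(2) ne] .
  ultimately show ?thesis using ne by blast
qed

text \<open>Writes of the value \<open>vinit\<close> are ruled out as well: in the serialization
  such a read always sees the initial value.\<close>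

lemma legal_nonlocal_read_init:
  assumes rd: "nonlocal_read H q r x vinit"
  shows "\<not> eligible_write serx.S r x w"
proof
  assume el: "eligible_write serx.S r x w"
  have rsp: "responds H q r" and rds: "reads H q r x vinit"
    using rd by (auto simp: nonlocal_read_def reads_def)
  have "q \<in> set H" using responds_in_set(1)[OF rsp] .
  then obtain \<nu> where \<nu>: "node H \<nu>" "q \<in> set \<nu>" by (rule node_exists[OF history])
  have r: "r \<in> set \<nu>" using node_response[OF history \<nu> rsp] .
  obtain \<mu> where \<mu>: "w \<in> set \<mu>" "node H \<mu>" using eligible_node[OF el] .
  note m = nonlocal_eligible[OF rd \<nu> r el \<mu>]
  have "node_reads H x vinit \<nu>" using rds \<nu>(2) r unfolding node_reads_def by blast
  then have "(\<nu>, \<mu>) \<in> RW G x" using m \<nu> \<mu> unfolding RW_iff by blast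
  then have "rk \<nu> < rk \<mu>" using rk_less \<nu> \<mu> by blast
  with m show False by simp
qed

lemma legal_nonlocal_read:
  assumes rd: "nonlocal_read H q r x v" and v: "v \<noteq> vinit"
  shows "\<exists>w. eligible_write serx.S r x w \<and> kind w = WriteReq x v \<and>
    (\<forall>w'. eligible_write serx.S r x w' \<and> w' \<noteq> w \<longrightarrow> before serx.S w' w)"
proof -
  have rsp: "responds H q r" using rd by (auto simp: nonlocal_read_def reads_def)
  have "q \<in> set H" using responds_in_set(1)[OF rsp] .
  then obtain \<nu> where \<nu>: "node H \<nu>" "q \<in> set \<nu>" by (rule node_exists[OF history])
  have r: "r \<in> set \<nu>" using node_response[OF history \<nu> rsp] .
  \<comment> \<open>\<open>wf_WR\<close> says only that the source writes \<open>v\<close>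
    somewhere; \<open>WR_serves_reads\<close> yields a write of \<open>v\<close> that the source
    does not overwrite itself.\<close>
  obtain \<kappa> w where wr: "(\<kappa>, \<nu>) \<in> WR G x" and w: "w \<in> set \<kappa>" and nl: "nonlocal_write H w x v"
    using graph(3) rd \<nu> r v unfolding WR_serves_reads_def verts by blast
  have kv: "\<kappa> \<in> vis G" using graph(2) wr unfolding wf_WR_def by blast
  have k: "node H \<kappa>" using vis_node[OF kv] .
  have kw: "kind w = WriteReq x v" using nl unfolding nonlocal_write_def by blast
  then have wx: "writes_to x w" by (auto simp: writes_to_def)
  have kvw: "\<kappa> \<in> visible_writers G x" using visible_writer[OF k kv w wx] .
  have "rk \<kappa> < rk \<nu>" using rk_less wr k \<nu>(1) by blast
  then have "before serx.S w r" using before_Hc_less[OF k \<nu>(1) w r] by blast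
  then have "eligible_write serx.S r x w" unfolding eligible_iff[OF w k r \<nu>(1)] using wx kv by blast
  moreover have "before serx.S w' w" if el: "eligible_write serx.S r x w'" and ne: "w' \<noteq> w" for w'
  proof -
    obtain \<mu> where \<mu>: "w' \<in> set \<mu>" "node H \<mu>" using eligible_node[OF el] .
    note m = nonlocal_eligible[OF rd \<nu> r el \<mu>]
    have w'x: "writes_to x w'" using el unfolding eligible_write_def by blast
    show ?thesis
    proof (cases "\<mu> = \<kappa>")
      case True
      have th: "thread w' = thread w" "w' \<in> set H" "w \<in> set H"
        using node_thread[OF k] \<mu>(1) True w by blast+
      \<comment> \<open>In a transaction a later write to \<open>x\<close> would make
        \<open>w\<close> local; an access has only one request.\<close>
      have "\<not> before H w w'"
      proof (cases "transaction H \<kappa>")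
        case tr: True
        show ?thesis using nl tr w \<mu>(1) True w'x unfolding nonlocal_write_def local_write_def by blast
      next
        case False
        then obtain a b where ab: "\<kappa> = [a, b]" "matches (kind a) (kind b)"
          using k unfolding node_def nontx_access_def responds_def by blast
        have "is_request (kind w)" "is_request (kind w')" using wx w'x by (auto simp: writes_to_def)
        then have False using ab matches_request[OF ab(2)] w \<mu>(1) True ne by auto
        then show ?thesis ..
      qed
      then have "before H w' w" using before_total[OF th(2,3) ne] by blast
      then show ?thesis using before_Hc_thread th by blast
    next
      case False
      have "(\<kappa>, \<mu>) \<notin> WW G x"
      proof
        assume "(\<kappa>, \<mu>) \<in> WW G x"
        then have "(\<nu>, \<mu>) \<in> RW G x" using wr m \<nu>(1) \<mu>(2) unfolding RW_iff by blast
        then have "rk \<nu> < rk \<mu>" using rk_less \<nu> \<mu> by blast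
        with m show False by simp
      qed
      then have "(\<mu>, \<kappa>) \<in> WW G x" using WW_total kvw m False by blast
      then have "rk \<mu> < rk \<kappa>" using rk_less \<mu> k by blast
      then show ?thesis using before_Hc_less \<mu> k w by blast
    qed
  qed
  ultimately show ?thesis using kw by blast
qed

lemma legal_Hc: "legal vinit serx.S"
  unfolding legal_def
proof (intro allI impI)
  fix q r x v assume "reads serx.S q r x v"
  then have rx: "reads Hx q r x v" unfolding reads_def responds_cong[OF serx.proj_S] .
  have "r \<in> set Hx" using rx responds_in_set(2) unfolding reads_def by blast
  \<comment> \<open>A value response is never one of the added actions, so the read already occurs
    in \<open>H\<close>.\<close>
  moreover have "\<not> final (kind r)" using rx by (auto simp: reads_def final_def)
  ultimately have "r \<in> set H" using final_comp unfolding set_Hx by blast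
  then have rd: "reads H q r x v" using rx responds_Hx unfolding reads_def by blast
  show "(\<exists>w. eligible_write serx.S r x w \<and> kind w = WriteReq x v \<and>
          (\<forall>w'. eligible_write serx.S r x w' \<and> w' \<noteq> w \<longrightarrow> before serx.S w' w)) \<or>
     ((\<nexists>w. eligible_write serx.S r x w) \<and> v = vinit)"
  proof (cases "\<exists>T. local_read H q x T")
    case True
    then show ?thesis using legal_local_read[OF rd] by blast
  next
    case False
    then have nl: "nonlocal_read H q r x v" using rd unfolding nonlocal_read_def by blast
    show ?thesis
    proof (cases "v = vinit")
      case True
      then show ?thesis using legal_nonlocal_read_init nl by blast
    next
      case False
      then show ?thesis using legal_nonlocal_read[OF nl] by blast
    qed
  qed
qed

lemma S_atomic: "ser.S \<in> H_atomic N vinit"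
  unfolding H_atomic_def
  using ser.history_S ser.non_interleaved_S completion_S legal_Hc by blast

end

theorem theorem14:
  fixes N :: nat and vinit :: int and TM :: "('i::infinite, 'x) history set"
  assumes "transactional_memory N TM"
    and "\<And>H. H \<in> TM \<Longrightarrow> cons vinit H"
    and "\<And>H. H \<in> TM \<Longrightarrow> \<exists>G \<in> Graph vinit H. acyclic_graph G"
  shows "\<forall>H \<in> TM. \<exists>S \<in> H_atomic N vinit. H \<sqsubseteq>\<^sub>H S"
proof
  fix H assume H: "H \<in> TM"
  then have h: "history N H" using assms(1) unfolding transactional_memory_def by blast
  obtain G where G: "G \<in> Graph vinit H" "acyclic (edges G)"
    using assms(3)[OF H] unfolding acyclic_graph_def by blast
  obtain rk :: "('i, 'x) node \<Rightarrow> nat" where rk: "inj_on rk {\<nu>. node H \<nu>}"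
    "\<forall>u \<in> {\<nu>. node H \<nu>}. \<forall>v \<in> {\<nu>. node H \<nu>}. (u, v) \<in> edges G \<longrightarrow> rk u < rk v"
    using topological_rank[OF finite_nodes[OF h] G(2)] by blast
  \<comment> \<open>Infinitely many identifiers remain outside the finite set used by
    \<open>H\<close>, enough for one per thread.\<close>
  obtain g :: "nat \<Rightarrow> 'i" where g: "inj g" "range g \<subseteq> UNIV - ident ` set H"
    using arb_countable_map[of "ident ` set H"] by auto
  interpret acyclic_opacity_graph N H g G vinit rk
    by unfold_locales (use h g assms(2)[OF H] G(1) rk in blast)+
  show "\<exists>S \<in> H_atomic N vinit. H \<sqsubseteq>\<^sub>H S"
    using S_atomic corresponds_S by blast
qed

end
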